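(* Let $w\in W_n$ and let $t\in W_n$ be the generator with $t(1)=-1$, $t(i)=i$ for $i\ge2$. Then $$p({}^-\vec w)^{\mathrm{ev}}=p({}^-\overrightarrow{tw})^{\mathrm{ev}}=p({}^-\overrightarrow{wt})^{\mathrm{ev}}.$$ Concretely, $\overrightarrow{tw}$ is obtained from $\vec w$ by changing the sign of the entry equal to $\pm1$, and $\overrightarrow{wt}$ is obtained from $\vec w$ by changing the sign of its first entry.
   Context: $W_n$ is the group of permutations $w$ of $\{\pm1,\dots,\pm n\}$ with $w(-i)=-w(i)$; products are compositions. $\vec w=(w(1),\dots,w(n))$ and ${}^-\vec w=(-w(n),\dots,-w(1),w(1),\dots,w(n))$. $p(x)$ denotes the shape of the Robinson–Schensted tableau of the integer sequence $x$ (row insertion; an inserted entry bumps the leftmost entry strictly greater). For a partition $r$, $r^{\mathrm{ev}}=(r_1^{\mathrm{ev}},r_2^{\mathrm{ev}},\dots)$ with $r_i^{\mathrm{ev}}=\lceil r_i/2\rceil$ for $i$ odd and $\lfloor r_i/2\rfloor$ for $i$ even. *)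

theory Defs
  imports "HOL-Combinatorics.Permutations"
begin

definition signed_perms :: "nat \<Rightarrow> (int \<Rightarrow> int) set" where
  "signed_perms n = {w. w permutes ({-int n..-1} \<union> {1..int n}) \<and> (\<forall>i. w (-i) = - w i)}"

definition gen_t :: "int \<Rightarrow> int" where
  "gen_t i = (if i = 1 then -1 else if i = -1 then 1 else i)"

definition wvec :: "nat \<Rightarrow> (int \<Rightarrow> int) \<Rightarrow> int list" where
  "wvec n w = map w [1..int n]"

definition mvec :: "nat \<Rightarrow> (int \<Rightarrow> int) \<Rightarrow> int list" where
  "mvec n w = map (\<lambda>x. - x) (rev (wvec n w)) @ wvec n w"

fun row_ins :: "int \<Rightarrow> int list list \<Rightarrow> int list list" where
  "row_ins x [] = [[x]]"
| "row_ins x (r # rs) =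
     (case dropWhile (\<lambda>y. y \<le> x) r of
        [] \<Rightarrow> (r @ [x]) # rs
      | y # suf \<Rightarrow> (takeWhile (\<lambda>y. y \<le> x) r @ x # suf) # row_ins y rs)"

definition RS_tableau :: "int list \<Rightarrow> int list list" where
  "RS_tableau xs = fold row_ins xs []"

text \<open>A partition is represented as a function from positive indices (starting at 1)
  to part sizes, zero beyond its length (and at index 0).\<close>
definition part_of_list :: "nat list \<Rightarrow> nat \<Rightarrow> nat" where
  "part_of_list l i = (if 1 \<le> i \<and> i \<le> length l then l ! (i - 1) else 0)"

definition RS_shape :: "int list \<Rightarrow> nat \<Rightarrow> nat" where
  "RS_shape xs = part_of_list (map length (RS_tableau xs))"

definition part_ev :: "(nat \<Rightarrow> nat) \<Rightarrow> nat \<Rightarrow> nat" where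
  "part_ev r i = (if odd i then (r i + 1) div 2 else r i div 2)"

end

theory Submission
  imports Defs
begin

text \<open>
  Colour a cell of a Young diagram black if its row and column index have the same parity; then
  \<open>r\<^sup>e\<^sup>v\<close> records the number of black cells in each row. For a signed permutation \<open>w\<close> let
  \<open>\<Lambda>(k, m)\<close> be the Robinson--Schensted shape of the points \<open>(i, w i)\<close> with \<open>\<bar>i\<bar> \<le> k\<close>, \<open>\<bar>w i\<bar> \<le> m\<close>.
  By Greene's theorem shapes depend only on the point set and transform under the symmetries of
  the square, so the growth rule of row insertion yields rules for extending the box in all four
  directions. They show that neighbouring shapes \<open>\<Lambda>\<close> differ by dominoes and determine
  the shape at the far corner of each unit square from the other three.

  Passing from \<open>w\<close> to \<open>w \<circ> t\<close> swaps the two central letters. Every domino has one black cell, and by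
  induction on \<open>k + m\<close> the black cells of both families agree: the local rules move the black cells in
  the same way, except in one configuration, which is excluded because swapping the central letters
  changes the maximal size of a union of \<open>r\<close> increasing subsequences by at most one, always in the
  same direction. The case \<open>t \<circ> w\<close> follows by taking inverses.
\<close>

section \<open>Chain families in planar point sets\<close>

text \<open>The sign change alters letters in the middle of the word, while row insertion only tells
  what a letter appended at the end does; the tableaux of the two words have no evident common
  stage. Growing a box outwards from the centre avoids this: the two maps differ only on the
  innermost columns, and every later extension is of the same kind for both. The central symmetry
  \<open>w (- i) = - w i\<close> makes points arrive in antipodal pairs, and such a pair contributes
  a domino although the shapes with only one of its points have no symmetry. The two families of
  shapes do not coincide, since a horizontal domino on one side may face a vertical one on the
  other; what survives is the black cell. The dangerous configuration is a common black cell that is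
  the right end of a horizontal domino in one family and the lower end of a vertical domino in the
  other: the next dominoes then go down in one family and to the right in the other. There the
  numbers of cells in the top rows drift apart by two, more than exchanging two letters can
  cause.\<close>

definition comparable :: "int \<times> int \<Rightarrow> int \<times> int \<Rightarrow> bool" where
  "comparable p q \<longleftrightarrow> fst p \<le> fst q \<and> snd p \<le> snd q \<or> fst q \<le> fst p \<and> snd q \<le> snd p"

definition chain_coloring :: "nat \<Rightarrow> (int \<times> int \<Rightarrow> nat) \<Rightarrow> (int \<times> int) set \<Rightarrow> bool" where
  "chain_coloring k f S \<longleftrightarrow> (\<forall>p\<in>S. f p < k) \<and> (\<forall>p\<in>S. \<forall>q\<in>S. f p = f q \<longrightarrow> comparable p q)"

definition greene :: "nat \<Rightarrow> (int \<times> int) set \<Rightarrow> nat" where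
  "greene k A = Max {card S | S. S \<subseteq> A \<and> (\<exists>f. chain_coloring k f S)}"

lemma finite_greene_set:
  "finite A \<Longrightarrow> finite {card S | S. S \<subseteq> A \<and> (\<exists>f. chain_coloring k f S)}"
  by (rule finite_subset[of _ "card ` Pow A"]) auto

lemma greene_ge:
  assumes "finite A" "S \<subseteq> A" "chain_coloring k f S"
  shows "card S \<le> greene k A"
  unfolding greene_def using assms by (intro Max_ge finite_greene_set) auto

lemma greene_obtain:
  assumes "finite A"
  obtains S f where "S \<subseteq> A" "chain_coloring k f S" "greene k A = card S"
proof -
  have "greene k A \<in> {card S | S. S \<subseteq> A \<and> (\<exists>f. chain_coloring k f S)}"
    unfolding greene_def
  proof (rule Max_in[OF finite_greene_set[OF assms]])
    have "chain_coloring k f {}" for f by (simp add: chain_coloring_def)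
    then show "{card S | S. S \<subseteq> A \<and> (\<exists>f. chain_coloring k f S)} \<noteq> {}"
      by blast
  qed
  then show thesis using that by auto
qed

text \<open>A colouring is transported along \<open>h\<close>. Comparability is asked for in one
  direction only, so a map that creates new comparable pairs still yields an inequality.\<close>

lemma greene_le_image:
  assumes fB: "finite B" and inj: "inj_on h A" and sub: "h ` A \<subseteq> B"
    and cmp: "\<And>p q. p \<in> A \<Longrightarrow> q \<in> A \<Longrightarrow> comparable p q \<Longrightarrow> comparable (h p) (h q)"
  shows "greene k A \<le> greene k B"
proof -
  have fA: "finite A" using finite_imageD finite_subset fB inj sub by metis
  obtain S f where S: "S \<subseteq> A" "chain_coloring k f S" "greene k A = card S"
    using greene_obtain[OF fA] .
  have injS: "inj_on h S" using inj S(1) inj_on_subset by blast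
  have "chain_coloring k (f \<circ> inv_into A h) (h ` S)"
    unfolding chain_coloring_def
  proof (intro conjI ballI impI)
    fix p' q' assume "p' \<in> h ` S" "q' \<in> h ` S" and e: "(f \<circ> inv_into A h) p' = (f \<circ> inv_into A h) q'"
    then obtain p q where pq: "p \<in> S" "q \<in> S" "p' = h p" "q' = h q" by blast
    moreover from this have "p \<in> A" "q \<in> A" using S(1) by auto
    ultimately show "comparable p' q'" using e S(2) cmp inj unfolding chain_coloring_def by simp
  qed (use S(1,2) inj in \<open>auto simp: chain_coloring_def subset_iff\<close>)
  moreover have "h ` S \<subseteq> B" using S(1) sub by auto
  ultimately have "card (h ` S) \<le> greene k B" using greene_ge[OF fB] by simp
  then show ?thesis using S(3) card_image[OF injS] by simp
qed

lemma greene_image_eq: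
  assumes fA: "finite A" and inj: "inj_on h A"
    and cmp: "\<And>p q. p \<in> A \<Longrightarrow> q \<in> A \<Longrightarrow> comparable (h p) (h q) \<longleftrightarrow> comparable p q"
  shows "greene k (h ` A) = greene k A"
proof (rule antisym)
  show "greene k A \<le> greene k (h ` A)"
    by (rule greene_le_image[where h = h]) (use assms in auto)
  show "greene k (h ` A) \<le> greene k A"
    by (rule greene_le_image[where h = "inv_into A h"])
       (use assms in \<open>auto simp: inv_into_into inj_on_inv_into\<close>)
qed

text \<open>The Knuth move between the words \<open>acb\<close> and \<open>cab\<close>. Passing to
  \<open>acb\<close> only makes the two moved points comparable, which gives one inequality; for the
  other, a chain using both points must be repaired with the help of \<open>(l, b)\<close>. By
  \<open>gap\<close> all remaining points lie strictly left or right of the three, so only their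
  heights matter.\<close>

lemma greene_knuth_after:
  fixes a b c i j l :: int
  assumes fB: "finite B" and a: "a < b" "b < c" and ij: "i < j" "j < l"
    and lb: "(l, b) \<in> B" and gap: "\<And>z. z \<in> B \<Longrightarrow> z = (l, b) \<or> fst z < i \<or> l < fst z"
  shows "greene k (insert (i, a) (insert (j, c) B)) = greene k (insert (i, c) (insert (j, a) B))"
    (is "greene k ?A1 = greene k ?A2")
proof (rule antisym)
  define h where "h = (\<lambda>z. if z = (i, c) then (j, c) else if z = (j, a) then (i, a) else z)"
  have nB: "(i, x) \<notin> B" "(j, x) \<notin> B" for x using gap[of "(i, x)"] gap[of "(j, x)"] ij by auto
  show "greene k ?A2 \<le> greene k ?A1"
  proof (rule greene_le_image[where h = h])
    show "inj_on h ?A2" using nB a ij by (auto simp: inj_on_def h_def)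
    show "h ` ?A2 \<subseteq> ?A1" by (auto simp: h_def)
    fix p q assume p: "p \<in> ?A2" and q: "q \<in> ?A2" and c: "comparable p q"
    have far: "h z = z" if "fst z < i \<or> l < fst z" for z using that ij by (auto simp: h_def)
    have near: "h (i,c) = (j,c)" "h (j,a) = (i,a)" "h (l,b) = (l,b)" using a ij by (auto simp: h_def)
    have inA: "z = (i,c) \<or> z = (j,a) \<or> z = (l,b) \<or> fst z < i \<or> l < fst z" if "z \<in> ?A2" for z
      using that gap[of z] by blast
    show "comparable (h p) (h q)"
      using inA[OF p] inA[OF q]
      by (elim disjE; use c a ij in \<open>simp add: far near comparable_def; linarith?\<close>)
  qed (use fB in auto)
  define g where "g = (\<lambda>z. if z = (j, c) then (i, c) else if z = (i, a) then (j, a) else z)"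
  obtain S f where S: "S \<subseteq> ?A1" "chain_coloring k f S" "greene k ?A1 = card S"
    using greene_obtain[of ?A1] fB by auto
  have fS: "finite S" using S(1) fB finite_subset by auto
  have Sc: "\<And>p. p \<in> S \<Longrightarrow> f p < k" "\<And>p q. p \<in> S \<Longrightarrow> q \<in> S \<Longrightarrow> f p = f q \<Longrightarrow> comparable p q"
    using S(2) by (auto simp: chain_coloring_def)
  have inS: "p = (i,a) \<or> p = (j,c) \<or> p = (l,b) \<or> fst p < i \<or> l < fst p" if "p \<in> S" for p
    using that S(1) gap[of p] by blast
  have injg: "inj_on g S" using nB a ij S(1) by (auto simp: inj_on_def g_def)
  have cg: "card (g ` S) = card S" using card_image[OF injg] .
  have gS: "g ` S \<subseteq> ?A2" using S(1) by (auto simp: g_def)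
  have hg: "h (g p) = p" if "p \<in> S" for p using that S(1) nB a ij by (auto simp: h_def g_def)
  have fA2: "finite ?A2" using fB by auto
  show "greene k ?A1 \<le> greene k ?A2"
  proof (cases "(i,a) \<in> S \<and> (j,c) \<in> S \<and> f (i,a) = f (j,c)")
    case False
    have "chain_coloring k (f \<circ> h) (g ` S)"
      unfolding chain_coloring_def
    proof (intro conjI ballI impI)
      fix p assume "p \<in> g ` S" then show "(f \<circ> h) p < k" using hg Sc by auto
    next
      fix p' q' assume "p' \<in> g ` S" "q' \<in> g ` S" "(f \<circ> h) p' = (f \<circ> h) q'"
      then obtain p q where pq: "p \<in> S" "q \<in> S" "p' = g p" "q' = g q" "f p = f q"
        using hg by auto
      have c: "comparable p q" using Sc pq by auto
      have n: "\<not> (p = (i,a) \<and> q = (j,c))" "\<not> (p = (j,c) \<and> q = (i,a))" using False pq by auto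
      have far: "g z = z" if "fst z < i \<or> l < fst z" for z using that ij by (auto simp: g_def)
      have near: "g (i,a) = (j,a)" "g (j,c) = (i,c)" "g (l,b) = (l,b)" using a ij by (auto simp: g_def)
      show "comparable p' q'"
        using inS[OF pq(1)] inS[OF pq(2)] unfolding pq(3,4)
        by (elim disjE; use n c a ij in \<open>simp add: far near comparable_def; linarith?\<close>)
    qed
    then show ?thesis using greene_ge[OF fA2 gS] cg S(3) by simp
  next
    case True
    define \<kappa> where "\<kappa> = f (i,a)"
    have T: "(i,a) \<in> S" "(j,c) \<in> S" "f (i,a) = \<kappa>" "f (j,c) = \<kappa>" using True by (auto simp: \<kappa>_def)
    have nlb: "(l,b) \<in> S \<Longrightarrow> f (l,b) \<noteq> \<kappa>" using Sc(2)[of "(j,c)" "(l,b)"] T a ij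
      by (auto simp: comparable_def)
    have low: "snd p \<le> a" if "p \<in> S" "f p = \<kappa>" "fst p < i" for p
      using Sc(2)[of p "(i,a)"] that T by (auto simp: comparable_def)
    have high: "c \<le> snd p" if "p \<in> S" "f p = \<kappa>" "l < fst p" for p
      using Sc(2)[of p "(j,c)"] that T ij by (auto simp: comparable_def)
    \<comment> \<open>The chain through \<open>(i,a)\<close> and \<open>(j,c)\<close> is broken; the witness \<open>(l,b)\<close> replaces \<open>(j,c)\<close>
      if it is unused, and otherwise the two chains exchange their tails.\<close>
    show ?thesis
    proof (cases "(l,b) \<in> S")
      case False
      define S' where "S' = insert (j,a) (insert (l,b) (S - {(i,a),(j,c)}))"
      have ja: "(j,a) \<notin> S" using S(1) nB a ij by auto
      have "card S' = Suc (Suc (card (S - {(i,a),(j,c)})))"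
        unfolding S'_def using fS ja False a ij by simp
      moreover have "card (S - {(i,a),(j,c)}) = card S - 2"
        using T a ij by (subst card_Diff_subset) auto
      moreover have "card S \<ge> 2" using card_mono[OF fS, of "{(i,a),(j,c)}"] T a ij by auto
      ultimately have cS: "card S' = card S" by linarith
      have "chain_coloring k (f((j,a) := \<kappa>, (l,b) := \<kappa>)) S'"
        unfolding chain_coloring_def
      proof (intro conjI ballI impI)
        fix p assume "p \<in> S'"
        then show "(f((j,a) := \<kappa>, (l,b) := \<kappa>)) p < k" using Sc(1)[of p] Sc(1)[OF T(1)] T by (auto simp: S'_def)
      next
        fix p q assume p: "p \<in> S'" and q: "q \<in> S'"
          and e: "(f((j,a) := \<kappa>, (l,b) := \<kappa>)) p = (f((j,a) := \<kappa>, (l,b) := \<kappa>)) q"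
        have tri: "z = (j,a) \<or> z = (l,b) \<or> z \<in> S \<and> z \<noteq> (j,a) \<and> z \<noteq> (l,b) \<and> (fst z < i \<or> l < fst z)"
          if "z \<in> S'" for z using that inS[of z] ja False unfolding S'_def by blast
        show "comparable p q"
        proof (cases "p \<in> S \<and> q \<in> S")
          case True
          then have "p \<noteq> (j,a)" "q \<noteq> (j,a)" "p \<noteq> (l,b)" "q \<noteq> (l,b)" using ja False by auto
          then show ?thesis using e Sc(2) True by auto
        next
          case F: False
          have A: "comparable (j,a) z \<and> comparable (l,b) z \<and> comparable z (j,a) \<and> comparable z (l,b)"
            if "z \<in> S" "f z = \<kappa>" "fst z < i \<or> l < fst z" for z
            using low[of z] high[of z] that a ij by (auto simp: comparable_def)
          have B: "comparable (j,a) (l,b)" "comparable (l,b) (j,a)" "\<And>z. comparable z z"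
            using a ij by (auto simp: comparable_def)
          from tri[OF p] tri[OF q] e F A B show ?thesis by (auto simp: fun_upd_def split: if_splits)
        qed
      qed
      moreover have "S' \<subseteq> ?A2" using S(1) lb unfolding S'_def by auto
      ultimately have "card S' \<le> greene k ?A2" using greene_ge[OF fA2] by blast
      then show ?thesis using cS S(3) by simp
    next
      case lS: True
      define \<mu> where "\<mu> = f (l,b)"
      have nm: "\<mu> \<noteq> \<kappa>" using nlb lS by (simp add: \<mu>_def)
      have low': "snd p \<le> b" if "p \<in> S" "f p = \<mu>" "fst p < i" for p
        using Sc(2)[of p "(l,b)"] that lS ij by (auto simp: comparable_def \<mu>_def)
      have high': "b \<le> snd p" if "p \<in> S" "f p = \<mu>" "l < fst p" for p
        using Sc(2)[of p "(l,b)"] that lS ij by (auto simp: comparable_def \<mu>_def)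
      \<comment> \<open>The new chain \<open>\<kappa>\<close> is the old left part of
        \<open>\<kappa>\<close> (heights at most \<open>a\<close>), then \<open>(j,a)\<close>,
        \<open>(l,b)\<close>, then the old tail of \<open>\<mu>\<close> (heights at least
        \<open>b\<close>). The new chain \<open>\<mu>\<close> is its old left part (at most
        \<open>b\<close>), then \<open>(i,c)\<close>, then the old tail of \<open>\<kappa>\<close>
        (at least \<open>c\<close>).\<close>
      define f' where "f' = (\<lambda>z. if z = (j,a) \<or> z = (l,b) then \<kappa> else if z = (i,c) then \<mu>
         else if l < fst z \<and> f z = \<kappa> then \<mu> else if l < fst z \<and> f z = \<mu> then \<kappa> else f z)"
      have tri: "z = (j,a) \<or> z = (i,c) \<or> z = (l,b) \<or> z \<in> S \<and> (fst z < i \<or> l < fst z)"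
        if "z \<in> g ` S" for z using that inS unfolding g_def by force
      have f's: "f' (j,a) = \<kappa>" "f' (l,b) = \<kappa>" "f' (i,c) = \<mu>" using a ij by (auto simp: f'_def)
      have f'lo: "f' z = f z" if "fst z < i" for z using that ij by (auto simp: f'_def)
      have f'hi: "f' z = (if f z = \<kappa> then \<mu> else if f z = \<mu> then \<kappa> else f z)" if "l < fst z" for z
        using that ij by (auto simp: f'_def)
      have "chain_coloring k f' (g ` S)"
        unfolding chain_coloring_def
      proof (intro conjI ballI impI)
        fix p assume "p \<in> g ` S"
        then have t: "p = (j,a) \<or> p = (i,c) \<or> p = (l,b) \<or> p \<in> S \<and> (fst p < i \<or> l < fst p)"
          by (rule tri)
        show "f' p < k" using t Sc(1)[of p] Sc(1)[OF T(1)] Sc(1)[OF lS] T \<mu>_def f's f'lo[of p] f'hi[of p]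
          by (elim disjE conjE) (auto split: if_splits)
      next
        fix p q assume p: "p \<in> g ` S" and q: "q \<in> g ` S" and e: "f' p = f' q"
        have A: "comparable p q \<and> comparable q p" if "p \<in> S" "q \<in> S" "fst p < i" "l < fst q" "f' p = f' q" for p q
        proof -
          have e: "f p = f' q" using that f'lo by simp
          note hi = f'hi[OF that(4)]
          consider "f q = \<kappa>" "f p = \<mu>" | "f q = \<mu>" "f p = \<kappa>" | "f p = f q"
            using e hi by (auto split: if_splits)
          then have "snd p \<le> snd q"
          proof cases
            case 1 then show ?thesis using low'[of p] high[of q] that a by simp
          next
            case 2 then show ?thesis using low[of p] high'[of q] that a by simp
          next
            case 3 then show ?thesis using Sc(2)[of p q] that ij by (auto simp: comparable_def)
          qed
          then show ?thesis using that ij by (auto simp: comparable_def)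
        qed
        have B: "comparable p q" if "p \<in> S" "q \<in> S" "fst p < i" "fst q < i" "f' p = f' q" for p q
          using that f'lo Sc(2) by auto
        have C: "comparable p q" if "p \<in> S" "q \<in> S" "l < fst p" "l < fst q" "f' p = f' q" for p q
          using that f'hi Sc(2) nm by (auto split: if_splits)
        have D: "(f' z = \<kappa> \<longrightarrow> comparable (j,a) z \<and> comparable z (j,a) \<and> comparable (l,b) z \<and> comparable z (l,b)) \<and>
                 (f' z = \<mu> \<longrightarrow> comparable (i,c) z \<and> comparable z (i,c))"
            if "z \<in> S" "fst z < i \<or> l < fst z" for z
        proof (cases "fst z < i")
          case True
          then show ?thesis using low[of z] low'[of z] f'lo[of z] that a ij by (auto simp: comparable_def)
        next
          case False
          then have "l < fst z" using that by simp
          then show ?thesis using high[of z] high'[of z] f'hi[of z] that a ij nm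
            by (auto simp: comparable_def split: if_splits)
        qed
        have E: "comparable (j,a) (l,b)" "comparable (l,b) (j,a)" "\<And>z. comparable z z"
          using a ij by (auto simp: comparable_def)
        from tri[OF p] tri[OF q] show "comparable p q"
          by (elim disjE conjE; use e f's nm A B C D E in \<open>simp; metis\<close>)
      qed
      then show ?thesis using greene_ge[OF fA2 gS] cg S(3) by simp
    qed
  qed
qed

section \<open>Symmetries of the square\<close>

definition rotate_pt :: "int \<times> int \<Rightarrow> int \<times> int" where
  "rotate_pt p = (- fst p, - snd p)"

text \<open>Exchanges increasing and decreasing sequences. Unlike the half-turn and the diagonal
  reflection it does not preserve \<open>greene\<close>; it will transpose shapes.\<close>

definition flip_pt :: "int \<times> int \<Rightarrow> int \<times> int" where
  "flip_pt p = (fst p, - snd p)"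

lemma fst_snd_rotate_pt [simp]: "fst (rotate_pt p) = - fst p" "snd (rotate_pt p) = - snd p"
  by (auto simp: rotate_pt_def)

lemma fst_snd_flip_pt [simp]: "fst (flip_pt p) = fst p" "snd (flip_pt p) = - snd p"
  by (auto simp: flip_pt_def)

lemma rotate_pt_rotate_pt [simp]: "rotate_pt (rotate_pt p) = p"
  by (simp add: rotate_pt_def)

lemma flip_pt_flip_pt [simp]: "flip_pt (flip_pt p) = p"
  by (simp add: flip_pt_def)

lemma inj_on_pt [simp]: "inj_on rotate_pt A" "inj_on flip_pt A"
  by (metis inj_onI rotate_pt_rotate_pt, metis inj_onI flip_pt_flip_pt)

lemma greene_rotate: "finite A \<Longrightarrow> greene k (rotate_pt ` A) = greene k A"
  by (rule greene_image_eq) (auto simp: comparable_def)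

lemma greene_swap: "finite A \<Longrightarrow> greene k (prod.swap ` A) = greene k A"
  by (rule greene_image_eq) (auto simp: comparable_def)

text \<open>The half-turn reverses and negates a word, which turns \<open>bac\<close> and
  \<open>bca\<close> into the two sides of the previous move.\<close>

lemma greene_knuth_before:
  fixes a b c i j l :: int
  assumes fB: "finite B" and a: "a < b" "b < c" and ij: "l < i" "i < j"
    and lb: "(l, b) \<in> B" and gap: "\<And>z. z \<in> B \<Longrightarrow> z = (l, b) \<or> fst z < l \<or> j < fst z"
  shows "greene k (insert (i, a) (insert (j, c) B)) = greene k (insert (i, c) (insert (j, a) B))"
proof -
  have "greene k (insert (-j,-c) (insert (-i,-a) (rotate_pt ` B))) =
        greene k (insert (-j,-a) (insert (-i,-c) (rotate_pt ` B)))"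
  proof (rule greene_knuth_after[where l = "-l" and b = "-b"])
    show "(-l,-b) \<in> rotate_pt ` B" using lb by (force simp: rotate_pt_def)
    fix z assume "z \<in> rotate_pt ` B"
    then show "z = (- l, - b) \<or> fst z < - j \<or> - l < fst z"
      using gap by (force simp: rotate_pt_def)
  qed (use assms in auto)
  then have "greene k (rotate_pt ` (insert (i, a) (insert (j, c) B))) =
             greene k (rotate_pt ` (insert (i, c) (insert (j, a) B)))"
    by (simp add: insert_commute rotate_pt_def)
  then show ?thesis using fB by (simp only: greene_rotate finite_insert)
qed

section \<open>Knuth equivalence and tableaux\<close>

fun number :: "int \<Rightarrow> int list \<Rightarrow> (int \<times> int) list" where
  "number s [] = []"
| "number s (y # ys) = (s, y) # number (s + 1) ys"

lemma map_snd_number [simp]: "map snd (number s x) = x"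
  by (induction s x rule: number.induct) auto

lemma number_append: "number s (x @ y) = number s x @ number (s + int (length x)) y"
  by (induction s x rule: number.induct) (auto simp: algebra_simps)

lemma fst_number: "z \<in> set (number s x) \<Longrightarrow> s \<le> fst z \<and> fst z < s + int (length x)"
  by (induction s x rule: number.induct) force+

lemma sorted_number: "sorted_wrt (\<lambda>p q. fst p < fst q) (number s x)"
  by (induction s x rule: number.induct) (use fst_number in force)+

lemma set_number: "set (number s x) = (\<lambda>j. (s + int j, x ! j)) ` {..<length x}"
proof (induction s x rule: number.induct)
  case (2 s y ys)
  have "{..<length (y # ys)} = insert 0 (Suc ` {..<length ys})"
    by (simp add: lessThan_Suc_eq_insert_0)
  then show ?case using 2 by (simp add: image_image algebra_simps)
qed simp

text \<open>Only the order of the abscissas enters \<open>comparable\<close>, so a word may be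
  placed at any increasing positions, gaps included. This leaves the positions of a reading word
  free to choose.\<close>

lemma greene_le_same_word:
  assumes sx: "sorted_wrt (\<lambda>p q. fst p < fst q) xs" and sy: "sorted_wrt (\<lambda>p q. fst p < fst q) ys"
    and eq: "map snd xs = map snd ys"
  shows "greene k (set xs) \<le> greene k (set ys)"
proof -
  have len: "length xs = length ys" using eq map_eq_imp_length_eq by blast
  have fle: "fst (zs ! m) < fst (zs ! n) \<longleftrightarrow> m < n"
    if "sorted_wrt (\<lambda>p q. fst p < fst q) zs" "m < length zs" "n < length zs"
    for zs :: "(int \<times> int) list" and m n
    using sorted_wrt_nth_less[OF that(1), of m n] sorted_wrt_nth_less[OF that(1), of n m] that(2,3)
    by (cases m n rule: linorder_cases) auto
  define ix where "ix p = (THE n. n < length xs \<and> xs ! n = p)" for p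
  have ix: "ix (xs ! n) = n" if "n < length xs" for n
    unfolding ix_def using that fle[OF sx] by (intro the_equality) (auto, metis linorder_neqE_nat order_less_irrefl)
  show ?thesis
  proof (rule greene_le_image[where h = "\<lambda>p. ys ! ix p"])
    show "inj_on (\<lambda>p. ys ! ix p) (set xs)"
    proof (rule inj_onI)
      fix p q assume "p \<in> set xs" "q \<in> set xs" and e: "ys ! ix p = ys ! ix q"
      then obtain m n where mn: "m < length xs" "n < length xs" "p = xs ! m" "q = xs ! n"
        by (auto simp: in_set_conv_nth)
      then have "ys ! m = ys ! n" using e ix by simp
      then have "m = n" using fle[OF sy, of m n] fle[OF sy, of n m] mn len
        by (metis linorder_neqE_nat order_less_irrefl)
      then show "p = q" using mn by simp
    qed
    show "(\<lambda>p. ys ! ix p) ` set xs \<subseteq> set ys" using len ix by (force simp: set_conv_nth)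
    fix p q assume "p \<in> set xs" "q \<in> set xs" and c: "comparable p q"
    then obtain m n where mn: "m < length xs" "n < length xs" "p = xs ! m" "q = xs ! n"
      by (auto simp: in_set_conv_nth)
    have s: "snd (xs ! m) = snd (ys ! m)" "snd (xs ! n) = snd (ys ! n)"
      using mn eq len by (metis nth_map)+
    show "comparable (ys ! ix p) (ys ! ix q)"
      using c unfolding mn(3,4) ix[OF mn(1)] ix[OF mn(2)] comparable_def s
      using fle[OF sx, of m n] fle[OF sx, of n m] fle[OF sy, of m n] fle[OF sy, of n m] mn len
      by (auto simp: not_less[symmetric])
  qed auto
qed

lemma greene_same_word:
  assumes "sorted_wrt (\<lambda>p q. fst p < fst q) xs" "sorted_wrt (\<lambda>p q. fst p < fst q) ys"
    and "map snd xs = map snd ys"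
  shows "greene k (set xs) = greene k (set ys)"
  using greene_le_same_word[of xs ys] greene_le_same_word[of ys xs] assms by (simp add: antisym)

section \<open>Knuth moves and row insertion\<close>

inductive knuth_eq :: "int list \<Rightarrow> int list \<Rightarrow> bool" where
  knuth_after: "a < b \<Longrightarrow> b < c \<Longrightarrow> knuth_eq (u @ [a, c, b] @ v) (u @ [c, a, b] @ v)"
| knuth_before: "a < b \<Longrightarrow> b < c \<Longrightarrow> knuth_eq (u @ [b, a, c] @ v) (u @ [b, c, a] @ v)"
| knuth_refl: "knuth_eq x x"
| knuth_sym: "knuth_eq x y \<Longrightarrow> knuth_eq y x"
| knuth_trans: "knuth_eq x y \<Longrightarrow> knuth_eq y z \<Longrightarrow> knuth_eq x z"

lemma greene_knuth_eq:
  assumes "knuth_eq x y"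
  shows "greene k (set (number 0 x)) = greene k (set (number 0 y))"
  using assms
proof induction
  case (knuth_after a b c u v)
  define i where "i = int (length u)"
  define B where "B = insert (i + 2, b) (set (number 0 u) \<union> set (number (i + 3) v))"
  have "z = (i + 2, b) \<or> fst z < i \<or> i + 2 < fst z" if "z \<in> B" for z
    using that fst_number[of z 0 u] fst_number[of z "i + 3" v] unfolding B_def i_def by auto
  then have "greene k (insert (i, a) (insert (i + 1, c) B)) = greene k (insert (i, c) (insert (i + 1, a) B))"
    by (intro greene_knuth_after[where l = "i + 2" and b = b]) (use knuth_after in \<open>auto simp: B_def\<close>)
  then show ?case by (simp add: number_append B_def i_def insert_commute algebra_simps)
next
  case (knuth_before a b c u v)
  define i where "i = int (length u)"
  define B where "B = insert (i, b) (set (number 0 u) \<union> set (number (i + 3) v))"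
  have "z = (i, b) \<or> fst z < i \<or> i + 2 < fst z" if "z \<in> B" for z
    using that fst_number[of z 0 u] fst_number[of z "i + 3" v] unfolding B_def i_def by auto
  then have "greene k (insert (i + 1, a) (insert (i + 2, c) B)) = greene k (insert (i + 1, c) (insert (i + 2, a) B))"
    by (intro greene_knuth_before[where l = i and b = b]) (use knuth_before in \<open>auto simp: B_def\<close>)
  then show ?case by (simp add: number_append B_def i_def insert_commute algebra_simps)
qed auto

lemma knuth_eq_context: "knuth_eq x y \<Longrightarrow> knuth_eq (u @ x @ v) (u @ y @ v)"
proof (induction rule: knuth_eq.induct)
  case (knuth_after a b c u' v')
  then show ?case using knuth_eq.knuth_after[of a b c "u @ u'" "v' @ v"] by simp
next
  case (knuth_before a b c u' v')
  then show ?case using knuth_eq.knuth_before[of a b c "u @ u'" "v' @ v"] by simp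
qed (auto intro: knuth_refl knuth_sym knuth_trans)

lemma knuth_eq_move_left:
  "a < y \<Longrightarrow> sorted_wrt (<) (y # s) \<Longrightarrow> knuth_eq (y # s @ [a]) (y # a # s)"
proof (induction s arbitrary: y)
  case (Cons z s)
  have "knuth_eq ([y] @ (z # s @ [a]) @ []) ([y] @ (z # a # s) @ [])"
    using Cons by (intro knuth_eq_context) auto
  moreover have "knuth_eq ([] @ [y, z, a] @ s) ([] @ [y, a, z] @ s)"
    using Cons.prems by (intro knuth_sym[OF knuth_before]) auto
  ultimately show ?case using knuth_trans by auto
qed (simp add: knuth_refl)

lemma knuth_eq_move_right:
  "sorted_wrt (<) (r @ [a]) \<Longrightarrow> a < y \<Longrightarrow> knuth_eq (r @ [y, a]) (y # r @ [a])"
proof (induction r arbitrary: a rule: rev_induct)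
  case (snoc p r)
  have "knuth_eq (r @ [p, y, a] @ []) (r @ [y, p, a] @ [])"
    using snoc.prems by (intro knuth_after) (auto simp: sorted_wrt_append)
  moreover have "knuth_eq ([] @ (r @ [y, p]) @ [a]) ([] @ (y # r @ [p]) @ [a])"
    using snoc by (intro knuth_eq_context snoc.IH) (auto simp: sorted_wrt_append)
  ultimately show ?case using knuth_trans by auto
qed (simp add: knuth_refl)

text \<open>First \<open>a\<close> travels left across \<open>suf\<close>; each swap is witnessed by
  the preceding letter, whose value lies between the two. Then the bumped \<open>y\<close> travels
  left across \<open>pre\<close>, each swap witnessed by the letter right after it.\<close>

lemma knuth_eq_bump:
  assumes s: "sorted_wrt (<) r" and a: "a \<notin> set r"
    and d: "dropWhile (\<lambda>y. y \<le> a) r = y # suf"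
  shows "knuth_eq (r @ [a]) (y # takeWhile (\<lambda>y. y \<le> a) r @ a # suf)"
proof -
  define pre where "pre = takeWhile (\<lambda>y. y \<le> a) r"
  have r: "r = pre @ y # suf" using takeWhile_dropWhile_id[of "\<lambda>y. y \<le> a" r] d by (simp add: pre_def)
  have ya: "a < y" using hd_dropWhile[of "\<lambda>y. y \<le> a" r] d by simp
  have pa: "p < a" if "p \<in> set pre" for p
    using that set_takeWhileD[of p "\<lambda>y. y \<le> a" r] a unfolding pre_def
    by (metis order_le_imp_less_or_eq)
  have "knuth_eq (pre @ (y # suf @ [a]) @ []) (pre @ (y # a # suf) @ [])"
    using s ya by (intro knuth_eq_context knuth_eq_move_left) (auto simp: r sorted_wrt_append)
  moreover have "knuth_eq ([] @ (pre @ [y, a]) @ suf) ([] @ (y # pre @ [a]) @ suf)"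
    using s ya pa by (intro knuth_eq_context knuth_eq_move_right) (auto simp: r sorted_wrt_append)
  ultimately show ?thesis unfolding pre_def[symmetric] using knuth_trans by (auto simp: r)
qed

section \<open>Tableaux and their reading words\<close>

definition below :: "int list \<Rightarrow> int list \<Rightarrow> bool" where
  "below r s \<longleftrightarrow> length s \<le> length r \<and> (\<forall>j<length s. r ! j < s ! j)"

fun tableau :: "int list list \<Rightarrow> bool" where
  "tableau [] \<longleftrightarrow> True"
| "tableau [r] \<longleftrightarrow> sorted_wrt (<) r"
| "tableau (r # s # rs) \<longleftrightarrow> sorted_wrt (<) r \<and> below r s \<and> tableau (s # rs)"

lemma tableau_Cons: "tableau (r # rs) \<longleftrightarrow> sorted_wrt (<) r \<and> tableau rs \<and> (rs = [] \<or> below r (hd rs))"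
  by (cases rs) auto

lemma row_split:
  fixes r :: "int list"
  assumes "dropWhile (\<lambda>y. y \<le> a) r = y # suf"
  shows "r = takeWhile (\<lambda>y. y \<le> a) r @ y # suf" "a < y"
    "\<And>z. z \<in> set (takeWhile (\<lambda>y. y \<le> a) r) \<Longrightarrow> z \<le> a"
  using takeWhile_dropWhile_id[of "\<lambda>y. y \<le> a" r] assms hd_dropWhile[of "\<lambda>y. y \<le> a" r]
  by (auto dest: set_takeWhileD)

lemma mset_concat_row_ins: "mset (concat (row_ins a T)) = add_mset a (mset (concat T))"
proof (induction a T rule: row_ins.induct)
  case (2 a r rs)
  show ?case
  proof (cases "dropWhile (\<lambda>y. y \<le> a) r")
    case (Cons y suf)
    have "mset r = mset (takeWhile (\<lambda>y. y \<le> a) r) + add_mset y (mset suf)"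
      using row_split(1)[OF Cons] by (metis mset.simps(2) mset_append)
    then show ?thesis using 2[OF Cons] Cons by simp
  qed (simp del: dropWhile_eq_Nil_conv)
qed simp

lemma row_ins_Cons_hd:
  "hd (row_ins a (r # rs)) = (case dropWhile (\<lambda>y. y \<le> a) r of
     [] \<Rightarrow> r @ [a] | y # suf \<Rightarrow> takeWhile (\<lambda>y. y \<le> a) r @ a # suf)"
  by (cases "dropWhile (\<lambda>y. y \<le> a) r") (simp_all del: dropWhile_eq_Nil_conv)

text \<open>The entry below \<open>y\<close> exceeds \<open>y\<close>, so the bumped
  \<open>y\<close> lands weakly left of the column it leaves. There the entry above it is
  \<open>a\<close> or a letter of \<open>pre\<close>, and both are smaller than
  \<open>y\<close>.\<close>

lemma below_bump:
  assumes r: "sorted_wrt (<) (pre @ y # suf)" "a < y"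
    and b: "rs = [] \<or> below (pre @ y # suf) (hd rs)"
  shows "below (pre @ a # suf) (hd (row_ins y rs))"
proof (cases rs)
  case Nil
  have "(pre @ a # suf) ! 0 < y" using r by (cases pre) (auto simp: sorted_wrt_append)
  then show ?thesis using Nil by (simp add: below_def)
next
  case (Cons s ss)
  let ?r = "pre @ y # suf" and ?p = "length pre"
  have b: "below ?r s" using assms(3) Cons by simp
  have len: "length s \<le> Suc (?p + length suf)" using b by (simp add: below_def)
  have nth: "(pre @ a # suf) ! j = (if j = ?p then a else ?r ! j)" for j
    by (auto simp: nth_append nth_Cons' )
  have lt: "?r ! j < s ! j" if "j < length s" for j using b that by (simp add: below_def)
  have prey: "?r ! j < y" if "j < ?p" for j
    using r that by (auto simp: nth_append sorted_wrt_append)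
  have yp: "?r ! ?p = y" by simp
  show ?thesis
  proof (cases "dropWhile (\<lambda>z. z \<le> y) s")
    case Nil
    have all: "z \<le> y" if "z \<in> set s" for z using Nil that by (metis dropWhile_eq_Nil_conv)
    have q: "length s \<le> ?p"
    proof (rule ccontr)
      assume "\<not> length s \<le> ?p"
      then show False using lt[of ?p] all[of "s ! ?p"] yp by simp
    qed
    show ?thesis unfolding Cons row_ins_Cons_hd Nil below_def
      using q r(2) lt prey by (auto simp: nth nth_append less_Suc_eq)
  next
    case (Cons z suf')
    define pre' where "pre' = takeWhile (\<lambda>z. z \<le> y) s"
    have s: "s = pre' @ z # suf'" and z: "y < z" and pre': "\<And>x. x \<in> set pre' \<Longrightarrow> x \<le> y"
      using row_split[OF Cons] by (auto simp: pre'_def)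
    let ?q = "length pre'"
    have q: "?q \<le> ?p"
    proof (rule ccontr)
      assume "\<not> ?q \<le> ?p"
      then have "?p < ?q" by simp
      then have "s ! ?p \<in> set pre'" by (simp add: s nth_append)
      then show False using lt[of ?p] pre'[of "s ! ?p"] yp \<open>?p < ?q\<close> s by simp
    qed
    have nth': "(pre' @ y # suf') ! j = (if j = ?q then y else s ! j)" for j
      by (auto simp: nth_append nth_Cons' s)
    have "(pre @ a # suf) ! j < (pre' @ y # suf') ! j" if "j < length s" for j
      unfolding nth nth' using lt[OF that] prey[of ?q] q r(2) yp by auto
    then show ?thesis
      unfolding \<open>rs = s # ss\<close> row_ins_Cons_hd Cons below_def pre'_def[symmetric]
      using len s by simp
  qed
qed

lemma tableau_row_ins: "tableau T \<Longrightarrow> a \<notin> set (concat T) \<Longrightarrow> distinct (concat T) \<Longrightarrow> tableau (row_ins a T)"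
proof (induction a T rule: row_ins.induct)
  case (2 a r rs)
  show ?case
  proof (cases "dropWhile (\<lambda>y. y \<le> a) r")
    case Nil
    then have "\<forall>z\<in>set r. z \<le> a" by (metis dropWhile_eq_Nil_conv)
    then have "\<forall>z\<in>set r. z < a" using 2(3) by (auto simp: order_le_less)
    then show ?thesis using 2(2) unfolding row_ins.simps Nil
      by (auto simp: tableau_Cons sorted_wrt_append below_def nth_append)
  next
    case (Cons y suf)
    define pre where "pre = takeWhile (\<lambda>y. y \<le> a) r"
    have s: "r = pre @ y # suf" and z: "a < y" and pre: "\<And>x. x \<in> set pre \<Longrightarrow> x \<le> a"
      using row_split[OF Cons] by (auto simp: pre_def)
    have t: "tableau rs" "sorted_wrt (<) (pre @ y # suf)" "rs = [] \<or> below (pre @ y # suf) (hd rs)"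
      using 2(2) s by (auto simp: tableau_Cons)
    have pre': "x < a" if "x \<in> set pre" for x using pre[OF that] 2(3) that s by (auto simp: order_le_less)
    have "tableau (row_ins y rs)" using 2(1)[OF Cons] t 2(4) s by auto
    moreover have "sorted_wrt (<) (pre @ a # suf)" using t(2) z pre' by (auto simp: sorted_wrt_append)
    ultimately show ?thesis using below_bump[OF t(2) z t(3)] Cons
      by (simp add: tableau_Cons pre_def)
  qed
qed simp

text \<open>The reading word lists the last row first. A letter bumped to the front of its row
  therefore stands right behind the word of the lower rows, where it is inserted next.\<close>

lemma knuth_eq_row_ins:
  "tableau T \<Longrightarrow> a \<notin> set (concat T) \<Longrightarrow> distinct (concat T) \<Longrightarrow>
   knuth_eq (concat (rev T) @ [a]) (concat (rev (row_ins a T)))"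
proof (induction a T rule: row_ins.induct)
  case (2 a r rs)
  show ?case
  proof (cases "dropWhile (\<lambda>y. y \<le> a) r")
    case (Cons y suf)
    let ?r = "takeWhile (\<lambda>y. y \<le> a) r @ a # suf"
    have "y \<in> set r" using row_split(1)[OF Cons] by (metis in_set_conv_decomp)
    then have "knuth_eq (concat (rev rs) @ [y]) (concat (rev (row_ins y rs)))"
      using 2 Cons by (auto simp: tableau_Cons)
    then have "knuth_eq ([] @ (concat (rev rs) @ [y]) @ ?r) ([] @ (concat (rev (row_ins y rs))) @ ?r)"
      by (rule knuth_eq_context)
    moreover have "knuth_eq (concat (rev rs) @ (r @ [a]) @ []) (concat (rev rs) @ (y # ?r) @ [])"
      using 2(2,3) Cons by (intro knuth_eq_context knuth_eq_bump) (auto simp: tableau_Cons)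
    ultimately show ?thesis using Cons knuth_trans by auto
  qed (simp add: knuth_refl del: dropWhile_eq_Nil_conv)
qed (simp add: knuth_refl)

lemma RS_tableau_snoc [simp]: "RS_tableau (x @ [a]) = row_ins a (RS_tableau x)"
  by (simp add: RS_tableau_def)

lemma mset_concat_RS_tableau: "mset (concat (RS_tableau x)) = mset x"
  by (induction x rule: rev_induct) (simp add: RS_tableau_def, simp add: mset_concat_row_ins)

lemma RS_tableau_entries: "set (concat (RS_tableau x)) = set x"
  "distinct (concat (RS_tableau x)) \<longleftrightarrow> distinct x"
  using mset_concat_RS_tableau mset_eq_setD mset_eq_imp_distinct_iff by blast+

lemma tableau_RS_tableau: "distinct x \<Longrightarrow> tableau (RS_tableau x)"
proof (induction x rule: rev_induct)
  case (snoc a x)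
  then show ?case using tableau_row_ins[of "RS_tableau x" a] RS_tableau_entries[of x] by auto
qed (simp add: RS_tableau_def)

lemma knuth_eq_RS_tableau: "distinct x \<Longrightarrow> knuth_eq x (concat (rev (RS_tableau x)))"
proof (induction x rule: rev_induct)
  case (snoc a x)
  have "knuth_eq ([] @ x @ [a]) ([] @ concat (rev (RS_tableau x)) @ [a])"
    using snoc by (intro knuth_eq_context) auto
  moreover have "knuth_eq (concat (rev (RS_tableau x)) @ [a]) (concat (rev (row_ins a (RS_tableau x))))"
    using snoc.prems tableau_RS_tableau[of x] RS_tableau_entries[of x] by (intro knuth_eq_row_ins) auto
  ultimately show ?case using knuth_trans by auto
qed (simp add: RS_tableau_def knuth_refl)

section \<open>Greene's theorem\<close>

lemma greene_number:
  "sorted_wrt (\<lambda>p q. fst p < fst q) xs \<Longrightarrow> greene k (set xs) = greene k (set (number 0 (map snd xs)))"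
  by (rule greene_same_word) (auto simp: sorted_number)

text \<open>Negation exchanges the two sides of each elementary move. Hence the reading word of one
  tableau also represents the flipped point set, and no second insertion has to be studied.\<close>

lemma knuth_eq_uminus: "knuth_eq x y \<Longrightarrow> knuth_eq (map uminus x) (map uminus y)"
proof (induction rule: knuth_eq.induct)
  case (knuth_after a b c u v)
  then show ?case
    using knuth_sym[OF knuth_eq.knuth_after[of "-c" "-b" "-a" "map uminus u" "map uminus v"]] by simp
next
  case (knuth_before a b c u v)
  then show ?case
    using knuth_sym[OF knuth_eq.knuth_before[of "-c" "-b" "-a" "map uminus u" "map uminus v"]] by simp
qed (auto intro: knuth_refl knuth_sym knuth_trans)

section \<open>Young diagrams and shapes of point sets\<close>

definition young :: "(nat \<times> nat) set \<Rightarrow> bool" where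
  "young D \<longleftrightarrow> finite D \<and> (\<forall>i j i' j'. (i, j) \<in> D \<longrightarrow> i' \<le> i \<longrightarrow> j' \<le> j \<longrightarrow> (i', j') \<in> D)"

lemma youngD: "young D \<Longrightarrow> (i, j) \<in> D \<Longrightarrow> i' \<le> i \<Longrightarrow> j' \<le> j \<Longrightarrow> (i', j') \<in> D"
  by (auto simp: young_def)

lemma young_finite: "young D \<Longrightarrow> finite D"
  by (simp add: young_def)

lemma young_swap: "young D \<Longrightarrow> young (prod.swap ` D)"
  by (auto simp: young_def)

lemma down_closed_eq_lessThan_card:
  fixes J :: "nat set"
  assumes "finite J" "\<And>j j'. j \<in> J \<Longrightarrow> j' \<le> j \<Longrightarrow> j' \<in> J"
  shows "J = {..<card J}"
proof (cases "J = {}")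
  case False
  have "J = {..Max J}"
    using Max_ge[OF assms(1)] assms(2)[OF Max_in[OF assms(1) False]] by blast
  then have "J = {..<Suc (Max J)}" by (simp only: lessThan_Suc_atMost)
  then show ?thesis using card_lessThan by metis
qed simp

lemma young_row: "young D \<Longrightarrow> {j. (i, j) \<in> D} = {..<card {j. (i, j) \<in> D}}"
proof (rule down_closed_eq_lessThan_card)
  assume D: "young D"
  show "finite {j. (i, j) \<in> D}"
    by (rule finite_subset[of _ "snd ` D"]) (use young_finite[OF D] in \<open>force+\<close>)
qed (auto intro: youngD)

definition top_rows :: "nat \<Rightarrow> (nat \<times> nat) set \<Rightarrow> nat" where
  "top_rows k D = card {c \<in> D. fst c < k}"

lemma top_rows_Suc:
  assumes "finite D"
  shows "top_rows (Suc i) D = top_rows i D + card {j. (i, j) \<in> D}"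
proof -
  have "{c \<in> D. fst c < Suc i} = {c \<in> D. fst c < i} \<union> Pair i ` {j. (i, j) \<in> D}" by (auto simp: less_Suc_eq)
  moreover have "card (Pair i ` {j. (i, j) \<in> D}) = card {j. (i, j) \<in> D}"
    by (rule card_image) (auto simp: inj_on_def)
  moreover have "finite {j. (i, j) \<in> D}" using finite_vimageI[OF assms, of "Pair i"]
    by (simp add: vimage_def inj_on_def)
  ultimately show ?thesis unfolding top_rows_def using assms
    by (subst \<open>_ = _ \<union> _\<close>, subst card_Un_disjoint) auto
qed

lemma top_rows_insert:
  "finite D \<Longrightarrow> c \<notin> D \<Longrightarrow> top_rows k (insert c D) = top_rows k D + (if fst c < k then 1 else 0)"
proof -
  assume "finite D" "c \<notin> D"
  moreover have "{x \<in> insert c D. fst x < k} = (if fst c < k then insert c {x \<in> D. fst x < k} else {x \<in> D. fst x < k})"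
    by auto
  ultimately show ?thesis by (simp add: top_rows_def)
qed

text \<open>Greene's characterisation of row lengths taken as the definition. No reading order
  enters, so every symmetry that preserves \<open>comparable\<close> preserves the shape.\<close>

definition shape :: "(int \<times> int) set \<Rightarrow> (nat \<times> nat) set" where
  "shape A = {(i, j). j < greene (Suc i) A - greene i A}"

lemma shape_eqI:
  assumes "young D" "\<And>k. greene k A = top_rows k D"
  shows "shape A = D"
proof -
  have "greene (Suc i) A - greene i A = card {j. (i, j) \<in> D}" for i
    using assms top_rows_Suc young_finite by simp
  then have "(i, j) \<in> shape A \<longleftrightarrow> j \<in> {..<card {j. (i, j) \<in> D}}" for i j
    by (simp add: shape_def)
  then have "(i, j) \<in> shape A \<longleftrightarrow> (i, j) \<in> D" for i j
    by (simp only: young_row[OF assms(1), symmetric] mem_Collect_eq)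
  then show ?thesis by (simp add: set_eq_iff)
qed

text \<open>Rows are chains, so the first \<open>k\<close> rows form an admissible family.
  Conversely columns are antichains, so \<open>k\<close> chains meet a column in at most
  \<open>k\<close> cells, while the first \<open>k\<close> rows meet it in \<open>k\<close> cells or
  in all of it; summing over the columns gives the upper bound.\<close>

lemma greene_young:
  assumes D: "young D" and inj: "inj_on \<phi> D"
    and row: "\<And>i j j'. (i, j) \<in> D \<Longrightarrow> (i, j') \<in> D \<Longrightarrow> comparable (\<phi> (i, j)) (\<phi> (i, j'))"
    and col: "\<And>i i' j. (i, j) \<in> D \<Longrightarrow> (i', j) \<in> D \<Longrightarrow> i < i' \<Longrightarrow> \<not> comparable (\<phi> (i, j)) (\<phi> (i', j))"
  shows "greene k (\<phi> ` D) = top_rows k D"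
proof (rule antisym)
  have fD: "finite D" using young_finite[OF D] .
  define S where "S = {c \<in> D. fst c < k}"
  have "chain_coloring k (fst \<circ> inv_into D \<phi>) (\<phi> ` S)"
    using inj row unfolding chain_coloring_def S_def by auto
  then have "card (\<phi> ` S) \<le> greene k (\<phi> ` D)"
    by (intro greene_ge) (use fD in \<open>auto simp: S_def\<close>)
  moreover have "card (\<phi> ` S) = card S" by (rule card_image) (rule inj_on_subset[OF inj], auto simp: S_def)
  ultimately show "top_rows k D \<le> greene k (\<phi> ` D)" by (simp add: top_rows_def S_def)
next
  have fD: "finite D" using young_finite[OF D] .
  obtain S f where S: "S \<subseteq> \<phi> ` D" "chain_coloring k f S" "greene k (\<phi> ` D) = card S"
    using greene_obtain fD by blast
  define S0 where "S0 = {c \<in> D. \<phi> c \<in> S}"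
  have S0: "S = \<phi> ` S0" "S0 \<subseteq> D" using S(1) by (auto simp: S0_def)
  have fS0: "finite S0" using S0(2) fD finite_subset by blast
  define E where "E = {c \<in> D. fst c < k}"
  have fE: "finite E" using fD by (auto simp: E_def)
  define J where "J = snd ` D"
  have "card (S0 \<inter> snd -` {j}) \<le> card (E \<inter> snd -` {j})" for j
  proof -
    have symc: "comparable p q \<longleftrightarrow> comparable q p" for p q by (auto simp: comparable_def)
    have "inj_on (f \<circ> \<phi>) (S0 \<inter> snd -` {j})"
    proof (rule inj_onI)
      fix c d assume c: "c \<in> S0 \<inter> snd -` {j}" and d: "d \<in> S0 \<inter> snd -` {j}" and e: "(f \<circ> \<phi>) c = (f \<circ> \<phi>) d"
      then have "comparable (\<phi> c) (\<phi> d)" using S(2) S0 unfolding chain_coloring_def by auto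
      moreover obtain i i' where "c = (i, j)" "d = (i', j)" using c d by (cases c; cases d) auto
      ultimately show "c = d" using col[of i j i'] col[of i' j i] c d S0(2) symc
        by (metis IntD1 linorder_neqE_nat subsetD)
    qed
    moreover have "(f \<circ> \<phi>) ` (S0 \<inter> snd -` {j}) \<subseteq> {..<k}" using S(2) S0 unfolding chain_coloring_def by auto
    ultimately have k: "card (S0 \<inter> snd -` {j}) \<le> k"
      by (metis card_inj_on_le card_lessThan finite_lessThan)
    show ?thesis
    proof (cases "\<forall>i. (i, j) \<in> D \<longrightarrow> i < k")
      case True
      then have "S0 \<inter> snd -` {j} \<subseteq> E \<inter> snd -` {j}" using S0(2) by (auto simp: E_def)
      then show ?thesis using fE by (intro card_mono) auto
    next
      case False
      then obtain i where i: "(i, j) \<in> D" "k \<le> i" by auto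
      have "(\<lambda>i. (i, j)) ` {..<k} \<subseteq> E \<inter> snd -` {j}" using i youngD[OF D i(1)] by (auto simp: E_def)
      then have "card ((\<lambda>i. (i, j)) ` {..<k}) \<le> card (E \<inter> snd -` {j})" using fE by (intro card_mono) auto
      moreover have "card ((\<lambda>i. (i, j)) ` {..<k}) = k" by (subst card_image) (auto simp: inj_on_def)
      ultimately show ?thesis using k by simp
    qed
  qed
  moreover have "card B = (\<Sum>j\<in>J. card (B \<inter> snd -` {j}))" if "B \<subseteq> D" for B
  proof -
    have "B = (\<Union>j\<in>J. B \<inter> snd -` {j})" using that by (auto simp: J_def)
    moreover have "finite B" using that fD finite_subset by blast
    ultimately show ?thesis using fD
      by (subst \<open>B = (\<Union>j\<in>J. B \<inter> snd -` {j})\<close>, subst card_UN_disjoint) (auto simp: J_def)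
  qed
  ultimately have "card S0 \<le> card E" using S0(2) by (simp add: sum_mono E_def)
  moreover have "card S = card S0" unfolding S0(1) by (rule card_image) (rule inj_on_subset[OF inj S0(2)])
  ultimately show "greene k (\<phi> ` D) \<le> top_rows k D" using S(3) by (simp add: E_def top_rows_def)
qed

section \<open>Diagrams of tableaux\<close>

definition diagram :: "int list list \<Rightarrow> (nat \<times> nat) set" where
  "diagram T = {(i, j). i < length T \<and> j < length (T ! i)}"

lemma diagram_Nil [simp]: "diagram [] = {}"
  by (simp add: diagram_def)

lemma diagram_Cons: "diagram (r # rs) = Pair 0 ` {..<length r} \<union> apfst Suc ` diagram rs"
proof -
  have "(i, j) \<in> diagram (r # rs) \<longleftrightarrow> (i, j) \<in> Pair 0 ` {..<length r} \<union> apfst Suc ` diagram rs" for i j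
    by (cases i) (auto simp: diagram_def image_iff apfst_def map_prod_def split: prod.splits)
  then show ?thesis by auto
qed

lemma tableau_nth:
  "tableau T \<Longrightarrow> i < length T \<Longrightarrow> sorted_wrt (<) (T ! i)"
  "tableau T \<Longrightarrow> Suc i < length T \<Longrightarrow> below (T ! i) (T ! Suc i)"
proof (induction T arbitrary: i)
  case (Cons r rs)
  { case 1 then show ?case using Cons(1) by (cases i) (auto simp: tableau_Cons) }
  { case 2 then show ?case using Cons(2) by (cases i) (auto simp: tableau_Cons hd_conv_nth) }
qed simp_all

lemma tableau_column:
  assumes T: "tableau T" and "i < i'" "i' < length T" "j < length (T ! i')"
  shows "j < length (T ! i) \<and> T ! i ! j < T ! i' ! j"
  using assms(2-)
proof (induction i' rule: less_Suc_induct)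
  case (1 i)
  then show ?case using tableau_nth(2)[OF T, of i] by (simp add: below_def)
next
  case (2 i k l)
  then show ?case by (metis less_trans)
qed

lemma young_diagram: "tableau T \<Longrightarrow> young (diagram T)"
proof -
  assume T: "tableau T"
  have "diagram T = Sigma {..<length T} (\<lambda>i. {..<length (T ! i)})" by (auto simp: diagram_def)
  then have "finite (diagram T)" by simp
  moreover have "(i', j') \<in> diagram T" if "(i, j) \<in> diagram T" "i' \<le> i" "j' \<le> j" for i j i' j'
    using that tableau_column[OF T, of i' i j'] by (cases "i' = i") (auto simp: diagram_def)
  ultimately show ?thesis by (auto simp: young_def)
qed

text \<open>
  The reading word of a tableau, numbered with gaps: row \<open>i\<close> occupies positions \<open>s - i * N, s - i * N + 1, \<dots>\<close>,
  so that the position of an entry is an explicit function of its cell.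
\<close>

fun number_rows :: "int \<Rightarrow> int \<Rightarrow> int list list \<Rightarrow> (int \<times> int) list" where
  "number_rows N s [] = []"
| "number_rows N s (r # rs) = number_rows N (s - N) rs @ number s r"

lemma map_snd_number_rows [simp]: "map snd (number_rows N s T) = concat (rev T)"
  by (induction N s T rule: number_rows.induct) auto

lemma fst_number_rows:
  "\<forall>r\<in>set T. int (length r) \<le> N \<Longrightarrow> z \<in> set (number_rows N s T) \<Longrightarrow> fst z < s + N"
proof (induction N s T rule: number_rows.induct)
  case (2 N s r rs)
  then consider "z \<in> set (number_rows N (s - N) rs)" | "z \<in> set (number s r)" by auto
  then show ?case
  proof cases
    case 1
    moreover have "0 \<le> N" using 2(2) by force
    ultimately show ?thesis using 2 by fastforce
  next
    case 2
    then show ?thesis using fst_number[OF 2] \<open>\<forall>r\<in>set (r # rs). int (length r) \<le> N\<close> by force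
  qed
qed simp

lemma sorted_number_rows:
  "\<forall>r\<in>set T. int (length r) \<le> N \<Longrightarrow> sorted_wrt (\<lambda>p q. fst p < fst q) (number_rows N s T)"
proof (induction N s T rule: number_rows.induct)
  case (2 N s r rs)
  have "fst p < fst q" if "p \<in> set (number_rows N (s - N) rs)" "q \<in> set (number s r)" for p q
    using fst_number_rows[OF _ that(1)] fst_number[OF that(2)] 2(2) by force
  then show ?case using 2 by (simp add: sorted_wrt_append sorted_number)
qed simp

lemma set_number_rows:
  "set (number_rows N s T) = (\<lambda>(i, j). (s - int i * N + int j, T ! i ! j)) ` diagram T"
proof (induction N s T rule: number_rows.induct)
  case (2 N s r rs)
  then show ?case
    by (simp add: diagram_Cons set_number image_Un image_image split_def algebra_simps Un_commute)
qed simp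

text \<open>In the reading word lower rows come first and have larger entries within a column, so
  rows increase and columns decrease. Negating the letters exchanges these roles, and the same count
  applies to the transposed diagram.\<close>

lemma greene_tableau:
  assumes T: "tableau T"
  shows "greene k (set (number 0 (concat (rev T)))) = top_rows k (diagram T)"
    and "greene k (set (number 0 (map uminus (concat (rev T))))) = top_rows k (prod.swap ` diagram T)"
proof -
  \<comment> \<open>The block width has to bound every row length, so that different rows occupy
    disjoint ranges of positions; the total number of entries does.\<close>
  define N where "N = int (length (concat T))"
  have N: "\<forall>r\<in>set T. int (length r) \<le> N"
    unfolding N_def by (auto simp: length_concat intro: member_le_sum_list)
  define \<phi> where "\<phi> = (\<lambda>(i, j). (- (int i * N) + int j, T ! i ! j))"
  have \<phi>: "set (number_rows N 0 T) = \<phi> ` diagram T"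
    unfolding set_number_rows \<phi>_def by simp
  have srt: "sorted_wrt (\<lambda>p q. fst p < fst q) (number_rows N 0 T)" using sorted_number_rows[OF N] .
  have pos: "fst (\<phi> (i', j')) < fst (\<phi> (i, j))" if "(i, j) \<in> diagram T" "(i', j') \<in> diagram T" "i < i'" for i i' j j'
  proof -
    have "int j' < N" using that N nth_mem[of i' T] by (fastforce simp: diagram_def)
    moreover have "(int i + 1) * N \<le> int i' * N" using that by (intro mult_right_mono) (auto simp: N_def)
    ultimately show ?thesis using that by (simp add: \<phi>_def algebra_simps)
  qed
  have rowv: "snd (\<phi> (i, j)) < snd (\<phi> (i, j'))" if "(i, j) \<in> diagram T" "(i, j') \<in> diagram T" "j < j'" for i j j'
    using that sorted_wrt_nth_less[OF tableau_nth(1)[OF T], of i j j'] by (auto simp: diagram_def \<phi>_def)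
  have rowp: "fst (\<phi> (i, j)) < fst (\<phi> (i, j'))" if "j < j'" for i j j'
    using that by (simp add: \<phi>_def)
  have colv: "snd (\<phi> (i, j)) < snd (\<phi> (i', j))" if "(i, j) \<in> diagram T" "(i', j) \<in> diagram T" "i < i'" for i i' j
    using that tableau_column[OF T] by (auto simp: diagram_def \<phi>_def)
  have inj: "inj_on \<phi> (diagram T)"
  proof (rule inj_onI, clarify)
    fix i j i' j' assume a: "(i, j) \<in> diagram T" "(i', j') \<in> diagram T" "\<phi> (i, j) = \<phi> (i', j')"
    then have "i = i'" using pos[of i j i' j'] pos[of i' j' i j] by (cases i i' rule: linorder_cases) auto
    moreover from this have "j = j'" using a rowp[of j j' i] rowp[of j' j i] by (cases j j' rule: linorder_cases) auto
    ultimately show "i = i' \<and> j = j'" by simp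
  qed
  have yd: "young (diagram T)" using young_diagram[OF T] .
  have "greene k (\<phi> ` diagram T) = top_rows k (diagram T)"
  proof (rule greene_young[OF yd inj])
    show "comparable (\<phi> (i, j)) (\<phi> (i, j'))" if "(i, j) \<in> diagram T" "(i, j') \<in> diagram T" for i j j'
      using rowv[of i j j'] rowv[of i j' j] rowp[of j j' i] rowp[of j' j i] that
      by (cases j j' rule: linorder_cases) (auto simp: comparable_def)
    show "\<not> comparable (\<phi> (i, j)) (\<phi> (i', j))" if "(i, j) \<in> diagram T" "(i', j) \<in> diagram T" "i < i'" for i i' j
      using pos[OF that] colv[OF that] by (auto simp: comparable_def)
  qed
  then show "greene k (set (number 0 (concat (rev T)))) = top_rows k (diagram T)"
    unfolding \<phi>[symmetric] using greene_number[OF srt] by simp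
  define \<psi> where "\<psi> = flip_pt \<circ> \<phi> \<circ> prod.swap"
  have im: "\<psi> ` prod.swap ` diagram T = flip_pt ` set (number_rows N 0 T)"
    by (simp add: \<psi>_def \<phi> image_comp comp_assoc)
  have "greene k (\<psi> ` prod.swap ` diagram T) = top_rows k (prod.swap ` diagram T)"
  proof (rule greene_young[OF young_swap[OF yd]])
    show "inj_on \<psi> (prod.swap ` diagram T)"
      unfolding \<psi>_def by (intro comp_inj_on) (auto simp: inj image_comp comp_assoc)
    show "comparable (\<psi> (j, i)) (\<psi> (j, i'))" if "(j, i) \<in> prod.swap ` diagram T" "(j, i') \<in> prod.swap ` diagram T" for i i' j
    proof -
      have "(i, j) \<in> diagram T" "(i', j) \<in> diagram T" using that by auto
      then show ?thesis using pos[of i j i' j] pos[of i' j i j] colv[of i j i'] colv[of i' j i]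
        by (cases i i' rule: linorder_cases) (auto simp: comparable_def \<psi>_def)
    qed
    show "\<not> comparable (\<psi> (j, i)) (\<psi> (j', i))" if "(j, i) \<in> prod.swap ` diagram T" "(j', i) \<in> prod.swap ` diagram T" "j < j'" for i j j'
    proof -
      have "(i, j) \<in> diagram T" "(i, j') \<in> diagram T" using that by auto
      then show ?thesis using rowv[of i j j'] rowp[of j j' i] that(3)
        by (auto simp: comparable_def \<psi>_def)
    qed
  qed
  moreover have "greene k (flip_pt ` set (number_rows N 0 T)) =
      greene k (set (number 0 (map snd (map flip_pt (number_rows N 0 T)))))"
    using greene_number[of "map flip_pt (number_rows N 0 T)" k] srt by (simp add: sorted_wrt_map)
  moreover have "map snd (map flip_pt (number_rows N 0 T)) = map uminus (concat (rev T))"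
    by (simp only: map_snd_number_rows[of N 0 T, symmetric] map_map) (simp add: comp_def)
  ultimately show "greene k (set (number 0 (map uminus (concat (rev T))))) = top_rows k (prod.swap ` diagram T)"
    unfolding im by (simp only:)
qed

text \<open>Greene's theorem together with its dual for decreasing sequences: Knuth moves reduce a
  word to the reading word of its tableau, where optimal chain families are visible. Both shapes
  come from the same tableau, hence the transposition.\<close>

theorem shape_eq_diagram_RS_tableau:
  assumes srt: "sorted_wrt (\<lambda>p q. fst p < fst q) xs" and d: "distinct (map snd xs)"
  shows "shape (set xs) = diagram (RS_tableau (map snd xs))"
    and "shape (flip_pt ` set xs) = prod.swap ` diagram (RS_tableau (map snd xs))"
    and "greene k (set xs) = top_rows k (shape (set xs))"
proof -
  let ?x = "map snd xs" let ?T = "RS_tableau ?x"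
  have T: "tableau ?T" using d tableau_RS_tableau by blast
  have kn: "knuth_eq ?x (concat (rev ?T))" using knuth_eq_RS_tableau[OF d] .
  have g: "greene k (set xs) = top_rows k (diagram ?T)" for k
    using greene_number[OF srt] greene_knuth_eq[OF kn] greene_tableau(1)[OF T] by simp
  then show sh: "shape (set xs) = diagram ?T" using shape_eqI young_diagram T by blast
  show "greene k (set xs) = top_rows k (shape (set xs))" using g sh by simp
  have "greene k (flip_pt ` set xs) = top_rows k (prod.swap ` diagram ?T)" for k
  proof -
    have "sorted_wrt (\<lambda>p q. fst p < fst q) (map flip_pt xs)" using srt by (simp add: sorted_wrt_map)
    from greene_number[OF this] have "greene k (flip_pt ` set xs) = greene k (set (number 0 (map uminus ?x)))"
      by (simp add: comp_def)
    then show ?thesis using greene_knuth_eq[OF knuth_eq_uminus[OF kn]] greene_tableau(2)[OF T] by simp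
  qed
  then show "shape (flip_pt ` set xs) = prod.swap ` diagram ?T"
    using shape_eqI young_swap young_diagram T by blast
qed

section \<open>Local growth rules\<close>

text \<open>These are the point sets that read from left to right as words with distinct
  letters.\<close>

definition generic :: "(int \<times> int) set \<Rightarrow> bool" where
  "generic A \<longleftrightarrow> finite A \<and> inj_on fst A \<and> inj_on snd A"

lemma generic_subset: "generic A \<Longrightarrow> B \<subseteq> A \<Longrightarrow> generic B"
  unfolding generic_def by (meson finite_subset inj_on_subset)

lemma generic_finite: "generic A \<Longrightarrow> finite A"
  by (simp add: generic_def)

lemma generic_images:
  assumes "generic A"
  shows "generic (rotate_pt ` A)" "generic (flip_pt ` A)" "generic (prod.swap ` A)"
  using assms by (auto simp: generic_def inj_on_def)

lemma generic_sorted_list: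
  assumes "generic A"
  obtains xs where "sorted_wrt (\<lambda>p q. fst p < fst q) xs" "set xs = A" "distinct (map snd xs)"
proof -
  obtain l where l: "set l = A" "distinct l"
    using finite_distinct_list generic_finite[OF assms] by blast
  define xs where "xs = sort_key fst l"
  have s: "set xs = A" "distinct xs" using l by (auto simp: xs_def)
  have "distinct (map fst xs)" "distinct (map snd xs)"
    using s assms by (auto simp: generic_def distinct_map)
  moreover have "sorted (map fst xs)" by (simp add: xs_def)
  ultimately have "sorted_wrt (<) (map fst xs)" by (simp add: strict_sorted_iff)
  then have "sorted_wrt (\<lambda>p q. fst p < fst q) xs" by (simp add: sorted_wrt_map)
  then show thesis using that s \<open>distinct (map snd xs)\<close> by blast
qed

lemma young_shape: "generic A \<Longrightarrow> young (shape A)"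
  by (erule generic_sorted_list) (auto simp: shape_eq_diagram_RS_tableau(1) young_diagram tableau_RS_tableau)

lemma greene_eq_top_rows: "generic A \<Longrightarrow> greene k A = top_rows k (shape A)"
  by (erule generic_sorted_list) (use shape_eq_diagram_RS_tableau(3) in blast)

lemma shape_flip: "generic A \<Longrightarrow> shape (flip_pt ` A) = prod.swap ` shape A"
  by (erule generic_sorted_list) (auto simp: shape_eq_diagram_RS_tableau(1,2))

lemma shape_rotate: "generic A \<Longrightarrow> shape (rotate_pt ` A) = shape A"
  by (simp add: shape_def greene_rotate generic_finite)

lemma shape_swap: "generic A \<Longrightarrow> shape (prod.swap ` A) = shape A"
  by (simp add: shape_def greene_swap generic_finite)

section \<open>The new cell of an insertion and the cell of the largest letter\<close>

fun ins_row :: "int \<Rightarrow> int list list \<Rightarrow> nat" where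
  "ins_row a [] = 0"
| "ins_row a (r # rs) = (case dropWhile (\<lambda>y. y \<le> a) r of [] \<Rightarrow> 0 | y # suf \<Rightarrow> Suc (ins_row y rs))"

fun add_end :: "nat \<Rightarrow> int \<Rightarrow> int list list \<Rightarrow> int list list" where
  "add_end i m [] = [[m]]"
| "add_end 0 m (r # rs) = (r @ [m]) # rs"
| "add_end (Suc i) m (r # rs) = r # add_end i m rs"

lemma ins_row_le: "ins_row a T \<le> length T"
  by (induction a T rule: ins_row.induct) (auto split: list.split)

lemma length_add_end: "length T \<le> length (add_end i m T)" "i \<le> length T \<Longrightarrow> i < length (add_end i m T)"
  by (induction i m T rule: add_end.induct) auto

lemma map_length_add_end: "map length (add_end i m T) = map length (add_end i m' T)"
  by (induction i m T rule: add_end.induct) auto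

lemma map_length_row_ins: "map length (row_ins a T) = map length (add_end (ins_row a T) a T)"
proof (induction a T rule: row_ins.induct)
  case (2 a r rs)
  show ?case
  proof (cases "dropWhile (\<lambda>y. y \<le> a) r")
    case (Cons y suf)
    then show ?thesis using 2[OF Cons] arg_cong[OF row_split(1)[OF Cons], of length]
        map_length_add_end[of _ y rs a] by simp
  qed (simp del: dropWhile_eq_Nil_conv)
qed simp

lemma diagram_cong: "map length T = map length T' \<Longrightarrow> diagram T = diagram T'"
proof -
  assume e: "map length T = map length T'"
  have "diagram S = {(i, j). i < length (map length S) \<and> j < map length S ! i}" for S
    by (auto simp: diagram_def)
  then show ?thesis using e by (simp only:)
qed

lemma diagram_add_end:
  "i \<le> length T \<Longrightarrow> \<exists>j. (i, j) \<notin> diagram T \<and> diagram (add_end i m T) = insert (i, j) (diagram T)"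
proof (induction i m T rule: add_end.induct)
  case (1 i m)
  then show ?case by (auto simp: diagram_def)
next
  case (2 m r rs)
  show ?case by (rule exI[of _ "length r"]) (auto simp: diagram_Cons lessThan_Suc)
next
  case (3 i m r rs)
  then obtain j where j: "(i, j) \<notin> diagram rs" "diagram (add_end i m rs) = insert (i, j) (diagram rs)" by auto
  show ?case by (rule exI[of _ j]) (use j in \<open>auto simp: diagram_Cons\<close>)
qed

lemma diagram_row_ins:
  "\<exists>j. (ins_row a T, j) \<notin> diagram T \<and> diagram (row_ins a T) = insert (ins_row a T, j) (diagram T)"
  unfolding diagram_cong[OF map_length_row_ins] by (rule diagram_add_end[OF ins_row_le])

lemma ins_row_less_length: "ins_row a T < length (row_ins a T)"
  by (metis ins_row_le length_add_end(2) length_map map_length_row_ins)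

lemma length_row_ins_ge: "length T \<le> length (row_ins a T)"
  by (metis length_add_end(1) length_map map_length_row_ins)

lemma row_ins_max: "\<forall>z\<in>set (concat T). z < m \<Longrightarrow> row_ins m T = add_end 0 m T"
proof (cases T)
  case (Cons r rs)
  assume "\<forall>z\<in>set (concat T). z < m"
  then have d: "dropWhile (\<lambda>y. y \<le> m) r = []" using Cons by (auto simp: less_imp_le)
  show ?thesis unfolding Cons row_ins.simps d by simp
qed simp

text \<open>The maximal entry \<open>m\<close> is displaced only when the insertion path ends in its row.\<close>

lemma row_ins_add_end:
  "i \<le> length T \<Longrightarrow> a < m \<Longrightarrow> \<forall>z\<in>set (concat T). z < m \<Longrightarrow>
   row_ins a (add_end i m T) = add_end (if ins_row a T = i then Suc i else i) m (row_ins a T)"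
proof (induction i m T arbitrary: a rule: add_end.induct)
  case (2 m r rs)
  show ?case
  proof (cases "dropWhile (\<lambda>y. y \<le> a) r")
    case Nil
    then have d: "dropWhile (\<lambda>y. y \<le> a) (r @ [m]) = [m]" "takeWhile (\<lambda>y. y \<le> a) (r @ [m]) = r"
      using 2 by (auto simp: dropWhile_append takeWhile_append)
    show ?thesis using d Nil 2 row_ins_max[of rs m]
      by (simp del: dropWhile_eq_Nil_conv)
  next
    case (Cons y suf)
    then have "\<not> (\<forall>x\<in>set r. x \<le> a)" by (metis dropWhile_eq_Nil_conv list.distinct(1))
    then have d: "dropWhile (\<lambda>y. y \<le> a) (r @ [m]) = y # suf @ [m]"
      "takeWhile (\<lambda>y. y \<le> a) (r @ [m]) = takeWhile (\<lambda>y. y \<le> a) r"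
      using Cons by (auto simp: dropWhile_append takeWhile_append)
    show ?thesis using d Cons by simp
  qed
next
  case (3 i m r rs)
  show ?case
  proof (cases "dropWhile (\<lambda>y. y \<le> a) r")
    case Nil
    then show ?thesis using 3 by (simp del: dropWhile_eq_Nil_conv)
  next
    case (Cons y suf)
    have "y \<in> set r" using row_split(1)[OF Cons] by (metis in_set_conv_decomp)
    then show ?thesis using 3 Cons by simp
  qed
qed auto

text \<open>A largest letter is always last in its row, and when displaced it displaces nothing
  further. All other entries evolve as if it were absent.\<close>

lemma RS_tableau_insert_max:
  assumes "\<forall>z\<in>set (x @ y). z < m"
  shows "\<exists>i\<le>length (RS_tableau (x @ y)). RS_tableau (x @ m # y) = add_end i m (RS_tableau (x @ y))"
  using assms
proof (induction y rule: rev_induct)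
  case Nil
  then have "row_ins m (RS_tableau x) = add_end 0 m (RS_tableau x)"
    using RS_tableau_entries(1)[of x] by (intro row_ins_max) auto
  then show ?case by (intro exI[of _ 0]) simp
next
  case (snoc a y)
  then obtain i where i: "i \<le> length (RS_tableau (x @ y))" "RS_tableau (x @ m # y) = add_end i m (RS_tableau (x @ y))"
    by auto
  let ?T = "RS_tableau (x @ y)"
  let ?i = "if ins_row a ?T = i then Suc i else i"
  have snoc': "RS_tableau (x @ y @ [a]) = row_ins a ?T" "RS_tableau (x @ m # y @ [a]) = row_ins a (RS_tableau (x @ m # y))"
    by (simp_all add: RS_tableau_def)
  have "RS_tableau (x @ m # y @ [a]) = add_end ?i m (RS_tableau (x @ y @ [a]))"
    unfolding snoc' i(2)
    by (rule row_ins_add_end[OF i(1)]) (use snoc.prems RS_tableau_entries(1)[of "x @ y"] in auto)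
  moreover have "?i \<le> length (RS_tableau (x @ y @ [a]))"
    unfolding snoc' using i(1) ins_row_less_length[of a ?T] length_row_ins_ge[of ?T a] by auto
  ultimately show ?case by blast
qed

section \<open>Extending a point set in the four directions\<close>

lemma shape_insert_right:
  assumes g: "generic (insert p A)" and p: "\<forall>z\<in>A. fst z < fst p"
  shows "\<exists>c. c \<notin> shape A \<and> shape (insert p A) = insert c (shape A)"
proof -
  obtain xs where xs: "sorted_wrt (\<lambda>p q. fst p < fst q) xs" "set xs = A" "distinct (map snd xs)"
    using generic_sorted_list[OF generic_subset[OF g subset_insertI]] .
  have "snd p \<notin> set (map snd xs)" using g p xs(2) by (auto simp: generic_def inj_on_def)
  then have "shape (set (xs @ [p])) = diagram (RS_tableau (map snd (xs @ [p])))"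
    using xs p by (intro shape_eq_diagram_RS_tableau(1)) (auto simp: sorted_wrt_append)
  moreover have "shape (set xs) = diagram (RS_tableau (map snd xs))"
    using xs by (intro shape_eq_diagram_RS_tableau(1)) auto
  ultimately show ?thesis using diagram_row_ins[of "snd p" "RS_tableau (map snd xs)"] xs(2) by auto
qed

lemma shape_insert_left:
  assumes g: "generic (insert p A)" and p: "\<forall>z\<in>A. fst p < fst z"
  shows "\<exists>c. c \<notin> shape A \<and> shape (insert p A) = insert c (shape A)"
  using shape_insert_right[of "rotate_pt p" "rotate_pt ` A"] p
    shape_rotate[OF g] shape_rotate[OF generic_subset[OF g subset_insertI]] generic_images(1)[OF g] by auto

lemma shape_insert_top:
  assumes g: "generic (insert p A)" and p: "\<forall>z\<in>A. snd z < snd p"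
  shows "\<exists>c. c \<notin> shape A \<and> shape (insert p A) = insert c (shape A)"
  using shape_insert_right[of "prod.swap p" "prod.swap ` A"] p
    shape_swap[OF g] shape_swap[OF generic_subset[OF g subset_insertI]] generic_images(3)[OF g] by auto

lemma shape_insert_bottom:
  assumes g: "generic (insert p A)" and p: "\<forall>z\<in>A. snd p < snd z"
  shows "\<exists>c. c \<notin> shape A \<and> shape (insert p A) = insert c (shape A)"
  using shape_insert_left[of "prod.swap p" "prod.swap ` A"] p
    shape_swap[OF g] shape_swap[OF generic_subset[OF g subset_insertI]] generic_images(3)[OF g] by auto

text \<open>Fomin's local rule, for \<open>p\<close> the last letter and \<open>q\<close> the
  largest. If inserting \<open>p\<close> without \<open>q\<close> ends in the very cell occupied by
  \<open>q\<close>, then \<open>q\<close> is pushed to the end of the next row.\<close>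

lemma shape_insert_right_top:
  assumes g: "generic (insert p (insert q A))"
    and p: "\<forall>z\<in>insert q A. fst z < fst p" and q: "\<forall>z\<in>insert p A. snd z < snd q"
    and c: "c \<notin> shape A" "shape (insert p A) = insert c (shape A)" "shape (insert q A) = insert c (shape A)"
  shows "\<exists>d. fst d = Suc (fst c) \<and> shape (insert p (insert q A)) = insert d (insert c (shape A))"
proof -
  obtain xs where xs: "sorted_wrt (\<lambda>p q. fst p < fst q) xs" "set xs = insert q A" "distinct (map snd xs)"
    using generic_sorted_list[OF generic_subset[OF g subset_insertI]] .
  then obtain y z where yz: "xs = y @ q # z" by (metis insertI1 split_list)
  have A: "set (y @ z) = A"
  proof -
    have "q \<notin> set (y @ z)" using xs(3) by (auto simp: yz)
    moreover have "q \<notin> A" using q by auto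
    ultimately show ?thesis using xs(2) yz by auto
  qed
  have sp: "snd p \<notin> set (map snd xs)" using g p xs(2) by (auto simp: generic_def inj_on_def)
  have fp: "\<forall>z\<in>set xs. fst z < fst p" using p xs(2) by auto
  let ?a = "snd p" and ?m = "snd q" and ?y = "map snd y" and ?z = "map snd z"
  let ?T = "RS_tableau (?y @ ?z)"
  have s: "shape A = diagram ?T"
    using shape_eq_diagram_RS_tableau(1)[of "y @ z"] xs(1,3) A by (auto simp: yz sorted_wrt_append)
  have sq: "shape (insert q A) = diagram (RS_tableau (?y @ ?m # ?z))"
    using shape_eq_diagram_RS_tableau(1)[of xs] xs by (simp add: yz)
  have "shape (set ((y @ z) @ [p])) = diagram (RS_tableau (map snd ((y @ z) @ [p])))"
    by (rule shape_eq_diagram_RS_tableau(1)) (use xs(1,3) sp fp in \<open>auto simp: yz sorted_wrt_append\<close>)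
  then have spA: "shape (insert p A) = diagram (row_ins ?a ?T)"
    using A by (simp add: RS_tableau_def)
  have "shape (set (xs @ [p])) = diagram (RS_tableau (map snd (xs @ [p])))"
    by (rule shape_eq_diagram_RS_tableau(1)) (use xs(1,3) sp fp in \<open>auto simp: sorted_wrt_append\<close>)
  then have spq: "shape (insert p (insert q A)) = diagram (row_ins ?a (RS_tableau (?y @ ?m # ?z)))"
    unfolding set_append xs(2) by (simp add: RS_tableau_def yz insert_commute)
  have max: "\<forall>v\<in>set (?y @ ?z). v < ?m" using q A by auto
  obtain i where i: "i \<le> length ?T" "RS_tableau (?y @ ?m # ?z) = add_end i ?m ?T"
    using RS_tableau_insert_max[OF max] by auto
  obtain j where j: "(i, j) \<notin> diagram ?T" "diagram (add_end i ?m ?T) = insert (i, j) (diagram ?T)"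
    using diagram_add_end[OF i(1)] by blast
  obtain l where l: "(ins_row ?a ?T, l) \<notin> diagram ?T"
      "diagram (row_ins ?a ?T) = insert (ins_row ?a ?T, l) (diagram ?T)"
    using diagram_row_ins by blast
  \<comment> \<open>The common cell \<open>c\<close> is read once as the cell of the largest letter
    and once as the end of the insertion path of \<open>p\<close>; this makes the two row indices
    equal, which is the displacing case of \<open>row_ins_add_end\<close>.\<close>
  have "c = (i, j)" using c(1,3) j unfolding s sq i(2) by blast
  moreover have "c = (ins_row ?a ?T, l)" using c(1,2) l unfolding s spA by blast
  ultimately have r: "ins_row ?a ?T = i" "fst c = i" by auto
  have "row_ins ?a (add_end i ?m ?T) = add_end (Suc i) ?m (row_ins ?a ?T)"
    using row_ins_add_end[OF i(1), of ?a ?m] q max RS_tableau_entries(1)[of "?y @ ?z"] r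
    by (simp del: set_concat)
  moreover have "Suc i \<le> length (row_ins ?a ?T)" using ins_row_less_length[of ?a ?T] r by simp
  ultimately obtain k where "diagram (row_ins ?a (add_end i ?m ?T)) = insert (Suc i, k) (diagram (row_ins ?a ?T))"
    using diagram_add_end by metis
  then show ?thesis using r spq i(2) spA c(2) by (intro exI[of _ "(Suc i, k)"]) auto
qed

lemma shape_insert_left_bottom:
  assumes g: "generic (insert p (insert q A))"
    and p: "\<forall>z\<in>insert q A. fst p < fst z" and q: "\<forall>z\<in>insert p A. snd q < snd z"
    and c: "c \<notin> shape A" "shape (insert p A) = insert c (shape A)" "shape (insert q A) = insert c (shape A)"
  shows "\<exists>d. fst d = Suc (fst c) \<and> shape (insert p (insert q A)) = insert d (insert c (shape A))"
proof -
  have r: "shape (rotate_pt ` A) = shape A" "shape (rotate_pt ` insert p A) = shape (insert p A)"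
    "shape (rotate_pt ` insert q A) = shape (insert q A)"
    "shape (rotate_pt ` insert p (insert q A)) = shape (insert p (insert q A))"
    by (rule shape_rotate[OF generic_subset[OF g]], blast)+
  show ?thesis
    using shape_insert_right_top[of "rotate_pt p" "rotate_pt q" "rotate_pt ` A" c] p q c
      generic_images(1)[OF g] r
    by auto
qed

lemma swap_image_eq_iff: "prod.swap ` X = Y \<longleftrightarrow> X = prod.swap ` Y"
proof -
  have "prod.swap ` prod.swap ` Z = Z" for Z :: "('c \<times> 'd) set" by (simp add: image_image)
  then show ?thesis by metis
qed

text \<open>Flipping sends bottom to top and transposes shapes, so the next row of the previous rule
  becomes the next column.\<close>

lemma shape_insert_right_bottom:
  assumes g: "generic (insert p (insert q A))"
    and p: "\<forall>z\<in>insert q A. fst z < fst p" and q: "\<forall>z\<in>insert p A. snd q < snd z"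
    and c: "c \<notin> shape A" "shape (insert p A) = insert c (shape A)" "shape (insert q A) = insert c (shape A)"
  shows "\<exists>d. snd d = Suc (snd c) \<and> shape (insert p (insert q A)) = insert d (insert c (shape A))"
proof -
  have r: "shape (flip_pt ` A) = prod.swap ` shape A"
    "shape (flip_pt ` insert p A) = prod.swap ` shape (insert p A)"
    "shape (flip_pt ` insert q A) = prod.swap ` shape (insert q A)"
    "shape (flip_pt ` insert p (insert q A)) = prod.swap ` shape (insert p (insert q A))"
    by (rule shape_flip[OF generic_subset[OF g]], blast)+
  have "\<exists>d. fst d = Suc (fst (prod.swap c)) \<and> shape (insert (flip_pt p) (insert (flip_pt q) (flip_pt ` A)))
       = insert d (insert (prod.swap c) (shape (flip_pt ` A)))"
    by (rule shape_insert_right_top)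
      (use p q c generic_images(2)[OF g] r in \<open>auto simp: swap_image_eq_iff prod.swap_def\<close>)
  then obtain d where d: "fst d = Suc (snd c)"
    "prod.swap ` shape (insert p (insert q A)) = insert d (insert (prod.swap c) (prod.swap ` shape A))"
    using r by auto
  then show ?thesis by (intro exI[of _ "prod.swap d"]) (simp add: swap_image_eq_iff image_image)
qed

lemma shape_insert_left_top:
  assumes g: "generic (insert p (insert q A))"
    and p: "\<forall>z\<in>insert q A. fst p < fst z" and q: "\<forall>z\<in>insert p A. snd z < snd q"
    and c: "c \<notin> shape A" "shape (insert p A) = insert c (shape A)" "shape (insert q A) = insert c (shape A)"
  shows "\<exists>d. snd d = Suc (snd c) \<and> shape (insert p (insert q A)) = insert d (insert c (shape A))"
proof -
  have r: "shape (rotate_pt ` A) = shape A" "shape (rotate_pt ` insert p A) = shape (insert p A)"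
    "shape (rotate_pt ` insert q A) = shape (insert q A)"
    "shape (rotate_pt ` insert p (insert q A)) = shape (insert p (insert q A))"
    by (rule shape_rotate[OF generic_subset[OF g]], blast)+
  show ?thesis
    using shape_insert_right_bottom[of "rotate_pt p" "rotate_pt q" "rotate_pt ` A" c] p q c
      generic_images(1)[OF g] r
    by auto
qed

text \<open>The point is both the last and the largest letter, so it is appended to the first row
  without bumping.\<close>

lemma shape_insert_corner_right_top:
  assumes g: "generic (insert p A)" and p: "\<forall>z\<in>A. fst z < fst p \<and> snd z < snd p"
  shows "\<exists>j. (0, j) \<notin> shape A \<and> shape (insert p A) = insert (0, j) (shape A)"
proof -
  obtain xs where xs: "sorted_wrt (\<lambda>p q. fst p < fst q) xs" "set xs = A" "distinct (map snd xs)"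
    using generic_sorted_list[OF generic_subset[OF g subset_insertI]] .
  have "snd p \<notin> set (map snd xs)" using p xs(2) by auto
  then have "shape (set (xs @ [p])) = diagram (RS_tableau (map snd (xs @ [p])))"
    using xs p by (intro shape_eq_diagram_RS_tableau(1)) (auto simp: sorted_wrt_append)
  moreover have "shape (set xs) = diagram (RS_tableau (map snd xs))"
    using xs by (intro shape_eq_diagram_RS_tableau(1)) auto
  moreover have "row_ins (snd p) (RS_tableau (map snd xs)) = add_end 0 (snd p) (RS_tableau (map snd xs))"
    using p xs(2) RS_tableau_entries(1)[of "map snd xs"] by (intro row_ins_max) auto
  ultimately show ?thesis
    using diagram_add_end[of 0 "RS_tableau (map snd xs)" "snd p"] xs(2) by auto
qed

lemma shape_insert_corner_left_bottom:
  assumes g: "generic (insert p A)" and p: "\<forall>z\<in>A. fst p < fst z \<and> snd p < snd z"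
  shows "\<exists>j. (0, j) \<notin> shape A \<and> shape (insert p A) = insert (0, j) (shape A)"
  using shape_insert_corner_right_top[of "rotate_pt p" "rotate_pt ` A"] p
    shape_rotate[OF g] shape_rotate[OF generic_subset[OF g subset_insertI]] generic_images(1)[OF g] by auto

lemma shape_insert_corner_right_bottom:
  assumes g: "generic (insert p A)" and p: "\<forall>z\<in>A. fst z < fst p \<and> snd p < snd z"
  shows "\<exists>i. (i, 0) \<notin> shape A \<and> shape (insert p A) = insert (i, 0) (shape A)"
proof -
  have "\<exists>j. (0, j) \<notin> shape (flip_pt ` A) \<and> shape (insert (flip_pt p) (flip_pt ` A)) = insert (0, j) (shape (flip_pt ` A))"
    by (rule shape_insert_corner_right_top) (use p generic_images(2)[OF g] in auto)
  then obtain j where "(0, j) \<notin> prod.swap ` shape A"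
      "prod.swap ` shape (insert p A) = insert (0, j) (prod.swap ` shape A)"
    using shape_flip[OF g] shape_flip[OF generic_subset[OF g subset_insertI]] by auto
  then show ?thesis by (intro exI[of _ j]) (auto simp: swap_image_eq_iff image_image)
qed

lemma shape_insert_corner_left_top:
  assumes g: "generic (insert p A)" and p: "\<forall>z\<in>A. fst p < fst z \<and> snd z < snd p"
  shows "\<exists>i. (i, 0) \<notin> shape A \<and> shape (insert p A) = insert (i, 0) (shape A)"
  using shape_insert_corner_right_bottom[of "rotate_pt p" "rotate_pt ` A"] p
    shape_rotate[OF g] shape_rotate[OF generic_subset[OF g subset_insertI]] generic_images(1)[OF g] by auto

section \<open>Domino growth\<close>

definition covers :: "(nat \<times> nat) set \<Rightarrow> (nat \<times> nat) set \<Rightarrow> bool" where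
  "covers X P \<longleftrightarrow> young X \<and> young P \<and> (\<exists>c. c \<notin> X \<and> P = insert c X)"

text \<open>The growth rule at the right-top or left-bottom corner of a box. If \<open>P\<close> and
  \<open>Q\<close> differ, \<open>Z\<close> is forced to be their union, so only a collision
  \<open>P = Q\<close> calls for a rule. At the other two corners, in \<open>col_square\<close>, a
  collision moves to the next column instead of the next row.\<close>

definition row_square where
  "row_square X P Q Z \<longleftrightarrow> covers X P \<and> covers X Q \<and> covers P Z \<and> covers Q Z \<and>
     (\<forall>c. c \<notin> X \<longrightarrow> P = insert c X \<longrightarrow> Q = insert c X \<longrightarrow>
        (\<exists>d. fst d = Suc (fst c) \<and> Z = insert d (insert c X)))"

definition col_square where
  "col_square X P Q Z \<longleftrightarrow> covers X P \<and> covers X Q \<and> covers P Z \<and> covers Q Z \<and>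
     (\<forall>c. c \<notin> X \<longrightarrow> P = insert c X \<longrightarrow> Q = insert c X \<longrightarrow>
        (\<exists>d. snd d = Suc (snd c) \<and> Z = insert d (insert c X)))"

definition hstep where
  "hstep X Z i j \<longleftrightarrow> young X \<and> young Z \<and> (i, j) \<notin> X \<and> (i, Suc j) \<notin> X \<and>
     Z = insert (i, Suc j) (insert (i, j) X)"

definition vstep where
  "vstep X Z i j \<longleftrightarrow> young X \<and> young Z \<and> (i, j) \<notin> X \<and> (Suc i, j) \<notin> X \<and>
     Z = insert (Suc i, j) (insert (i, j) X)"

definition dstep where
  "dstep X Z \<longleftrightarrow> (\<exists>i j. hstep X Z i j \<or> vstep X Z i j)"

text \<open>Local rules of domino insertion. Two dominoes that can be added to the same diagram
  overlap only if they share their first cell; the clauses treat equal horizontal, equal vertical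
  and crossed dominoes. In the crossed case the dominoes are completed to a two by two
  block.\<close>

definition domino_square where
  "domino_square X U V Z \<longleftrightarrow> dstep X U \<and> dstep X V \<and> dstep U Z \<and> dstep V Z \<and>
     (\<forall>i j. hstep X U i j \<longrightarrow> V = U \<longrightarrow> (\<exists>l. hstep U Z (Suc i) l)) \<and>
     (\<forall>i j. vstep X U i j \<longrightarrow> V = U \<longrightarrow> (\<exists>l. vstep U Z l (Suc j))) \<and>
     (\<forall>i j. hstep X U i j \<and> vstep X V i j \<or> vstep X U i j \<and> hstep X V i j \<longrightarrow>
        Z = insert (Suc i, Suc j) (U \<union> V))"

lemma young_new_cell:
  assumes "young X" "young (insert (i, j) X)" "(i, j) \<notin> X"
  shows "(i, j') \<in> X \<longleftrightarrow> j' < j" "(i', j) \<in> X \<longleftrightarrow> i' < i"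
proof -
  show "(i, j') \<in> X \<longleftrightarrow> j' < j"
    using youngD[OF assms(1), of i j' i j] youngD[OF assms(2), of i j i j'] assms(3) by (cases "j' < j") auto
  show "(i', j) \<in> X \<longleftrightarrow> i' < i"
    using youngD[OF assms(1), of i' j i j] youngD[OF assms(2), of i j i' j] assms(3) by (cases "i' < i") auto
qed

lemma new_cell_unique:
  assumes X: "young X" and c: "young (insert c X)" "c \<notin> X" and d: "young (insert d X)" "d \<notin> X"
    and "fst c = fst d \<or> snd c = snd d"
  shows "c = d"
proof -
  obtain i j where c': "c = (i, j)" by (cases c)
  obtain k l where d': "d = (k, l)" by (cases d)
  have "(i, j') \<in> X \<longleftrightarrow> j' < j" "(i', j) \<in> X \<longleftrightarrow> i' < i" for i' j'
    using young_new_cell[OF X] c unfolding c' by blast+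
  moreover have "(k, j') \<in> X \<longleftrightarrow> j' < l" "(i', l) \<in> X \<longleftrightarrow> i' < k" for i' j'
    using young_new_cell[OF X] d unfolding d' by blast+
  ultimately show ?thesis using assms(6) unfolding c' d'
    by simp (metis less_irrefl linorder_neqE_nat)
qed

lemma hstep_cells:
  assumes "hstep X Z i j"
  shows "(i, j') \<in> X \<longleftrightarrow> j' < j" "(i', j) \<in> X \<longleftrightarrow> i' < i" "(i', Suc j) \<in> X \<longleftrightarrow> i' < i"
proof -
  note h = assms[unfolded hstep_def]
  have X: "young X" and Z: "young Z" and n: "(i, j) \<notin> X" "(i, Suc j) \<notin> X"
    and e: "Z = insert (i, Suc j) (insert (i, j) X)" using h by blast+
  show "(i, j') \<in> X \<longleftrightarrow> j' < j"
    using youngD[OF X, of i j' i j] youngD[OF Z, of i j i j'] n e by (cases "j' < j") auto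
  show "(i', j) \<in> X \<longleftrightarrow> i' < i"
    using youngD[OF X, of i' j i j] youngD[OF Z, of i j i' j] n e by (cases "i' < i") auto
  show "(i', Suc j) \<in> X \<longleftrightarrow> i' < i"
    using youngD[OF X, of i' "Suc j" i "Suc j"] youngD[OF Z, of i "Suc j" i' "Suc j"] n e by (cases "i' < i") auto
qed

lemma vstep_cells:
  assumes "vstep X Z i j"
  shows "(i', j) \<in> X \<longleftrightarrow> i' < i" "(i, j') \<in> X \<longleftrightarrow> j' < j" "(Suc i, j') \<in> X \<longleftrightarrow> j' < j"
proof -
  note h = assms[unfolded vstep_def]
  have X: "young X" and Z: "young Z" and n: "(i, j) \<notin> X" "(Suc i, j) \<notin> X"
    and e: "Z = insert (Suc i, j) (insert (i, j) X)" using h by blast+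
  show "(i', j) \<in> X \<longleftrightarrow> i' < i"
    using youngD[OF X, of i' j i j] youngD[OF Z, of i j i' j] n e by (cases "i' < i") auto
  show "(i, j') \<in> X \<longleftrightarrow> j' < j"
    using youngD[OF X, of i j' i j] youngD[OF Z, of i j i j'] n e by (cases "j' < j") auto
  show "(Suc i, j') \<in> X \<longleftrightarrow> j' < j"
    using youngD[OF X, of "Suc i" j' "Suc i" j] youngD[OF Z, of "Suc i" j "Suc i" j'] n e by (cases "j' < j") auto
qed

text \<open>\<open>Z\<close> contains both new cells but is only one cell larger than
  \<open>P\<close> and than \<open>Q\<close>.\<close>

lemma square_union:
  assumes "covers P Z" "covers Q Z" "P = insert c X" "Q = insert d X" "c \<noteq> d" "c \<notin> X" "d \<notin> X"
  shows "Z = insert d P" "Z = insert c Q"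
proof -
  obtain z z' where z: "Z = insert z P" "Z = insert z' Q" using assms(1,2) by (auto simp: covers_def)
  have "d \<in> Z" "c \<in> Z" unfolding z(2) assms(4) z(1) assms(3) using z assms(3,4) by auto
  moreover have "d \<notin> P" "c \<notin> Q" using assms by auto
  ultimately have "d = z" "c = z'" using z by auto
  then show "Z = insert d P" "Z = insert c Q" using z by auto
qed

lemma row_squareD:
  assumes "row_square X P Q Z" "P = insert c X" "Q = insert c X" "c \<notin> X"
  obtains d where "fst d = Suc (fst c)" "Z = insert d P" "d \<notin> P"
proof -
  obtain d where d: "fst d = Suc (fst c)" "Z = insert d P" using assms unfolding row_square_def by metis
  moreover have "covers P Z" using assms by (simp add: row_square_def)
  then have "d \<notin> P" using d(2) by (auto simp: covers_def)
  ultimately show thesis using that by blast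
qed

lemma col_squareD:
  assumes "col_square X P Q Z" "P = insert c X" "Q = insert c X" "c \<notin> X"
  obtains d where "snd d = Suc (snd c)" "Z = insert d P" "d \<notin> P"
proof -
  obtain d where d: "snd d = Suc (snd c)" "Z = insert d P" using assms unfolding col_square_def by metis
  moreover have "covers P Z" using assms by (simp add: col_square_def)
  then have "d \<notin> P" using d(2) by (auto simp: covers_def)
  ultimately show thesis using that by blast
qed

lemma hstep_middle:
  assumes "hstep X Z i j" "covers X P" "covers P Z"
  shows "P = insert (i, j) X"
proof -
  have Z: "Z = insert (i, Suc j) (insert (i, j) X)" "(i, j) \<notin> X" using assms(1) by (auto simp: hstep_def)
  obtain c where c: "c \<notin> X" "P = insert c X" "young P" using assms(2) by (auto simp: covers_def)
  have "c \<in> Z" using c assms(3) by (auto simp: covers_def)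
  then have "c = (i, j) \<or> c = (i, Suc j)" using Z c by auto
  moreover have "c \<noteq> (i, Suc j)" using youngD[OF c(3), of i "Suc j" i j] Z(2) c(2) by auto
  ultimately show ?thesis using c by simp
qed

lemma vstep_middle:
  assumes "vstep X Z i j" "covers X P" "covers P Z"
  shows "P = insert (i, j) X"
proof -
  have Z: "Z = insert (Suc i, j) (insert (i, j) X)" "(i, j) \<notin> X" using assms(1) by (auto simp: vstep_def)
  obtain c where c: "c \<notin> X" "P = insert c X" "young P" using assms(2) by (auto simp: covers_def)
  have "c \<in> Z" using c assms(3) by (auto simp: covers_def)
  then have "c = (i, j) \<or> c = (Suc i, j)" using Z c by auto
  moreover have "c \<noteq> (Suc i, j)" using youngD[OF c(3), of "Suc i" j i j] Z(2) c(2) by auto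
  ultimately show ?thesis using c by simp
qed

text \<open>A three by three grid of shapes around a box. \<open>P\<close> and \<open>S\<close>
  arise from \<open>X\<close> by adding a right point and then also its left partner,
  \<open>U\<close> and \<open>V\<close> by adding a top point and then also its bottom partner;
  double letters combine both. The four unit squares are the corners right-top, right-bottom,
  left-top and left-bottom, in this order, which is why row and column rules alternate as they
  do.\<close>

locale four_squares =
  fixes X P S U PU SU V PV SV :: "(nat \<times> nat) set"
  assumes sq1: "row_square X P U PU" and sq2: "col_square U PU V PV"
    and sq3: "col_square P S PU SU" and sq4: "row_square PU SU PV SV"
begin

lemma cov: "covers X P" "covers X U" "covers P PU" "covers U PU" "covers U V" "covers PU PV" "covers V PV"
  "covers P S" "covers S SU" "covers PU SU" "covers SU SV" "covers PV SV"
  using sq1 sq2 sq3 sq4 by (simp_all add: row_square_def col_square_def)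

lemma youngs: "young X" "young P" "young S" "young U" "young PU" "young SU" "young V" "young PV" "young SV"
  using cov unfolding covers_def by blast+

lemma transposed: "four_squares X U V P PU PV S SU SV"
proof -
  have "row_square A C B D" if "row_square A B C D" for A B C D
    using that unfolding row_square_def by blast
  moreover have "col_square A C B D" if "col_square A B C D" for A B C D
    using that unfolding col_square_def by blast
  ultimately show ?thesis using sq1 sq2 sq3 sq4 unfolding four_squares_def by blast
qed

text \<open>The squares \<open>sq1\<close> and \<open>sq4\<close> collide, in the first and in the
  second cell of the domino, and each sends a cell to row \<open>Suc i\<close>. Two cells added one
  after the other to the same row are adjacent.\<close>

lemma both_horizontal:
  assumes hV: "hstep X V i j" and hS: "hstep X S i j"
  shows "\<exists>l. hstep V SV (Suc i) l"
proof -
  have P: "P = insert (i, j) X" using hstep_middle[OF hS cov(1,8)] .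
  have U: "U = insert (i, j) X" using hstep_middle[OF hV cov(2,5)] .
  have nX: "(i, j) \<notin> X" "(i, Suc j) \<notin> X" using hV by (simp_all add: hstep_def)
  have V: "V = insert (i, Suc j) U" "S = insert (i, Suc j) P" using hV hS U P by (simp_all add: hstep_def)
  obtain n where n: "fst n = Suc i" "PU = insert n P" "n \<notin> P"
    using row_squareD[OF sq1 P U nX(1)] by (metis fst_conv)
  have PU: "P = U" using P U by simp
  have nd: "n \<noteq> (i, Suc j)" using n(1) by auto
  have dU: "(i, Suc j) \<notin> U" using nX U by simp
  have PV: "PV = insert (i, Suc j) PU" "PV = insert n V"
    using square_union[OF cov(6,7) n(2)[unfolded PU] V(1) nd n(3)[unfolded PU] dU] by auto
  have SU: "SU = insert (i, Suc j) PU"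
    using square_union[OF cov(9,10) V(2) n(2) nd[symmetric] dU[folded PU] n(3)] by auto
  have dPU: "(i, Suc j) \<notin> PU" using dU nd n PU by auto
  obtain m where m: "fst m = Suc i" "SV = insert m SU" "m \<notin> SU"
    using row_squareD[OF sq4 SU PV(1) dPU] by (metis fst_conv)
  have e: "SU = insert n V" using SU PV by simp
  obtain a b where ab: "n = (Suc i, a)" "m = (Suc i, b)" using n m by (cases n; cases m) auto
  have nV: "(Suc i, a) \<notin> V" using n nd V PU ab by auto
  have 1: "(Suc i, l) \<in> V \<longleftrightarrow> l < a" for l
    using young_new_cell(1)[OF youngs(7) _ nV] youngs(6) unfolding e ab by blast
  have mV: "(Suc i, b) \<notin> SU" using m ab by simp
  have 2: "(Suc i, l) \<in> SU \<longleftrightarrow> l < b" for l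
    using young_new_cell(1)[OF youngs(6) _ mV] youngs(9) unfolding m(2) ab by blast
  have 3: "l < b \<longleftrightarrow> l \<le> a" for l using 1[of l] 2[of l] e ab by auto
  have "b = Suc a" using 3[of a] 3[of "Suc a"] by simp
  then show ?thesis using youngs(7,9) nV mV m(2) e ab by (auto simp: hstep_def)
qed

lemma new_cell_down:
  assumes P: "P = insert (i, j) X" and U: "U = insert (i, j) X" and nX: "(i, j) \<notin> X"
    and Y: "young (insert (Suc i, j) P)" "(Suc i, j) \<notin> P"
  shows "PU = insert (Suc i, j) P"
proof -
  obtain n where n: "fst n = Suc i" "PU = insert n P" "n \<notin> P"
    using row_squareD[OF sq1 P U nX] by (metis fst_conv)
  have "n = (Suc i, j)"
    by (rule new_cell_unique[OF youngs(2) _ n(3) Y]) (use n youngs(5) in auto)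
  then show ?thesis using n by simp
qed

text \<open>The collision of \<open>sq1\<close> in the upper cell produces the lower cell of the
  domino. Then \<open>sq2\<close> and \<open>sq3\<close> collide in that cell and both yield the
  addable cell of column \<open>Suc j\<close>; finally \<open>sq4\<close> collides there and adds a
  cell in the row below it.\<close>

lemma both_vertical:
  assumes vV: "vstep X V i j" and vS: "vstep X S i j"
  shows "\<exists>l. vstep V SV l (Suc j)"
proof -
  have P: "P = insert (i, j) X" using vstep_middle[OF vS cov(1,8)] .
  have U: "U = insert (i, j) X" using vstep_middle[OF vV cov(2,5)] .
  have nX: "(i, j) \<notin> X" "(Suc i, j) \<notin> X" using vV by (simp_all add: vstep_def)
  have V: "V = insert (Suc i, j) U" "S = insert (Suc i, j) P" using vV vS U P by (simp_all add: vstep_def)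
  have dP: "(Suc i, j) \<notin> P" using nX P by simp
  have dU: "(Suc i, j) \<notin> U" using nX U by simp
  have PU: "PU = insert (Suc i, j) P"
    using new_cell_down[OF P U nX(1) youngs(3)[unfolded V(2)] dP] .
  have PU': "PU = insert (Suc i, j) U" using PU P U by simp
  have eq: "PU = V" "PU = S" using V PU PU' by simp_all
  obtain c where c: "snd c = Suc j" "PV = insert c PU" "c \<notin> PU"
    using col_squareD[OF sq2 PU' V(1) dU] by (metis snd_conv)
  obtain d where d: "snd d = Suc j" "SU = insert d S" "d \<notin> S"
    using col_squareD[OF sq3 V(2) PU dP] by (metis snd_conv)
  have cd: "c = d"
    by (rule new_cell_unique[of PU]) (use c d eq youngs(5,6,8) in simp_all)
  have SU: "SU = insert c PU" using d cd eq by simp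
  obtain m where m: "fst m = Suc (fst c)" "SV = insert m SU" "m \<notin> SU"
    using row_squareD[OF sq4 SU c(2,3)] .
  obtain a b where ab: "c = (a, Suc j)" "m = (Suc a, b)" using c(1) m(1) by (cases c; cases m) auto
  have cV: "(a, Suc j) \<notin> V" using c(3) ab eq(1) by simp
  have SUV: "SU = insert (a, Suc j) V" using SU ab eq(1) by simp
  have col: "(l, Suc j) \<in> V \<longleftrightarrow> l < a" for l
    using young_new_cell(2)[OF youngs(7) _ cV] youngs(6) unfolding SUV by blast
  \<comment> \<open>The rule of \<open>sq4\<close> gives the row of the last cell but not its
    column. As column \<open>Suc j\<close> of \<open>V\<close> ends above row \<open>i\<close>, row
    \<open>Suc a\<close> already reaches column \<open>j\<close>, and it does not contain column
    \<open>Suc j\<close>; this leaves only \<open>b = Suc j\<close>.\<close>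
  have "(i, Suc j) \<notin> V" using vstep_cells(2)[OF vV, of "Suc j"] V U by auto
  then have ai: "a \<le> i" using col[of i] by auto
  have mV: "(Suc a, b) \<notin> SU" using m(3) ab by simp
  have row: "(Suc a, l) \<in> SU \<longleftrightarrow> l < b" for l
    using young_new_cell(1)[OF youngs(6) _ mV] youngs(9) unfolding m(2) ab by blast
  have "(Suc i, j) \<in> V" using V by simp
  then have "(Suc a, j) \<in> V" by (rule youngD[OF youngs(7)]) (use ai in auto)
  then have "j < b" using row[of j] SUV by auto
  moreover have "(Suc a, Suc j) \<notin> SU" using col[of "Suc a"] SUV by auto
  then have "b \<le> Suc j" using row[of "Suc j"] by auto
  ultimately have "b = Suc j" by simp
  then show ?thesis using youngs(7,9) cV mV m(2) SUV ab by (intro exI[of _ a]) (auto simp: vstep_def)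
qed

text \<open>Three collisions occur: \<open>sq1\<close> in \<open>(i, j)\<close> yields
  \<open>(Suc i, j)\<close>, \<open>sq3\<close> in that cell yields \<open>(i, Suc j)\<close>, and
  \<open>sq4\<close> in this one yields the last cell of the block.\<close>

lemma horizontal_vertical:
  assumes hV: "hstep X V i j" and vS: "vstep X S i j"
  shows "hstep V SV (Suc i) j" "vstep S SV i (Suc j)" "SV = insert (Suc i, Suc j) (V \<union> S)"
proof -
  have P: "P = insert (i, j) X" using vstep_middle[OF vS cov(1,8)] .
  have U: "U = insert (i, j) X" using hstep_middle[OF hV cov(2,5)] .
  have nX: "(i, j) \<notin> X" "(Suc i, j) \<notin> X" "(i, Suc j) \<notin> X" using vS hV by (simp_all add: vstep_def hstep_def)
  have V: "V = insert (i, Suc j) U" "S = insert (Suc i, j) P" using vS hV U P by (simp_all add: vstep_def hstep_def)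
  have dP: "(Suc i, j) \<notin> P" using nX P by simp
  have dU: "(Suc i, j) \<notin> U" "(i, Suc j) \<notin> U" using nX U by simp_all
  have PU: "PU = insert (Suc i, j) P"
    using new_cell_down[OF P U nX(1) youngs(3)[unfolded V(2)] dP] .
  have PU': "PU = insert (Suc i, j) U" using PU P U by simp
  have eq: "PU = S" using V PU by simp
  have PV: "PV = insert (i, Suc j) PU" "PV = insert (Suc i, j) V"
    using square_union[OF cov(6,7) PU' V(1) _ dU] by simp_all
  obtain c where c: "snd c = Suc j" "SU = insert c S" "c \<notin> S"
    using col_squareD[OF sq3 V(2) PU dP] by (metis snd_conv)
  have dPU: "(i, Suc j) \<notin> PU" using PU P nX by simp
  have "c = (i, Suc j)"
    by (rule new_cell_unique[of PU]) (use c eq PV(1) dPU youngs(5,6,8) in simp_all)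
  then have SU: "SU = insert (i, Suc j) PU" using c eq by simp
  obtain m where m: "fst m = Suc i" "SV = insert m SU" "m \<notin> SU"
    using row_squareD[OF sq4 SU PV(1) dPU] by (metis fst_conv)
  obtain b where ab: "m = (Suc i, b)" using m by (cases m) auto
  have mV: "(Suc i, b) \<notin> SU" using m(3) ab by simp
  have row: "(Suc i, l) \<in> SU \<longleftrightarrow> l < b" for l
    using young_new_cell(1)[OF youngs(6) _ mV] youngs(9) unfolding m(2) ab by blast
  have "(Suc i, j) \<in> SU" using SU PU by simp
  then have "j < b" using row by simp
  moreover have "(Suc i, Suc j) \<notin> X" using youngD[OF youngs(1), of "Suc i" "Suc j" i "Suc j"] nX by auto
  then have dSU: "(Suc i, Suc j) \<notin> SU" using SU PU P by simp
  then have "b \<le> Suc j" using row[of "Suc j"] by auto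
  ultimately have b: "m = (Suc i, Suc j)" using ab by simp
  have SV: "SV = insert (Suc i, Suc j) (insert (i, Suc j) (insert (Suc i, j) (insert (i, j) X)))"
    using m(2) b SU PU P by simp
  show "hstep V SV (Suc i) j" using youngs(7,9) SV V U nX dSU SU PU P by (simp add: hstep_def insert_commute)
  show "vstep S SV i (Suc j)" using youngs(3,9) SV V P nX dSU SU PU by (simp add: vstep_def insert_commute)
  show "SV = insert (Suc i, Suc j) (V \<union> S)" using SV V U P by (simp add: insert_commute)
qed

lemma hstep_or_vstep_cells:
  assumes "hstep X Z i j \<and> d = (i, Suc j) \<or> vstep X Z i j \<and> d = (Suc i, j)"
  shows "(i, j) \<notin> X" "d \<notin> X" "Z = insert d (insert (i, j) X)" "d \<noteq> (i, j)"
    "\<And>Q. covers X Q \<Longrightarrow> covers Q Z \<Longrightarrow> Q = insert (i, j) X"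
proof -
  show "Q = insert (i, j) X" if "covers X Q" "covers Q Z" for Q
    using assms hstep_middle[OF _ that] vstep_middle[OF _ that] by blast
qed (use assms in \<open>auto simp: hstep_def vstep_def\<close>)

text \<open>The four cells of the two dominoes turn out to be distinct, so no square collides, all
  shapes of the grid are unions, and each domino is added unchanged after the other.\<close>

lemma disjoint_corners:
  assumes D: "hstep X V i j \<and> d = (i, Suc j) \<or> vstep X V i j \<and> d = (Suc i, j)"
    and E: "hstep X S k l \<and> e = (k, Suc l) \<or> vstep X S k l \<and> e = (Suc k, l)"
    and ne: "(i, j) \<noteq> (k, l)"
  shows "dstep V SV \<and> dstep S SV"
proof -
  note d = hstep_or_vstep_cells[OF D] and e = hstep_or_vstep_cells[OF E]
  have U: "U = insert (i, j) X" using d(5)[OF cov(2,5)] .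
  have P: "P = insert (k, l) X" using e(5)[OF cov(1,8)] .
  have PU: "PU = insert (i, j) P" "PU = insert (k, l) U"
    using square_union[OF cov(3,4) P U ne[symmetric] e(1) d(1)] .
  have de: "(k, l) \<noteq> d"
  proof
    assume "(k, l) = d"
    then have "i \<le> k" "j \<le> l" using D by auto
    then have "(i, j) \<in> P" using youngD[OF youngs(2), of k l i j] P by auto
    then show False using P d(1) ne by auto
  qed
  have ed: "(i, j) \<noteq> e"
  proof
    assume "(i, j) = e"
    then have "k \<le> i" "l \<le> j" using E by auto
    then have "(k, l) \<in> U" using youngD[OF youngs(4), of i j k l] U by auto
    then show False using U e(1) ne by auto
  qed
  have V: "V = insert d U" and S: "S = insert e P" using d(3) e(3) U P by simp_all
  have nU: "(k, l) \<notin> U" "d \<notin> U" and nP: "(i, j) \<notin> P" "e \<notin> P" using U P ne d e by simp_all blast+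
  have PV: "PV = insert d PU" "PV = insert (k, l) V"
    using square_union[OF cov(6,7) PU(2) V de nU] .
  have SU: "SU = insert e PU" "SU = insert (i, j) S"
    using square_union[OF cov(9,10) S PU(1) ed[symmetric] nP(2,1)] by simp_all
  have dd: "d \<noteq> e"
  proof
    assume "d = e"
    then consider "hstep X V i j" "vstep X S k l" "i = Suc k" "l = Suc j"
      | "vstep X V i j" "hstep X S k l" "k = Suc i" "j = Suc l" using D E ne by auto
    then show False
    proof cases
      case 1 then show False using hstep_cells(3)[OF 1(1), of k] e(1) by simp
    next
      case 2 then show False using hstep_cells(3)[OF 2(2), of i] d(1) by simp
    qed
  qed
  have "e \<notin> PU" unfolding PU(1) using nP(2) ed by auto
  moreover have "d \<notin> PU" unfolding PU(2) using nU(2) de by auto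
  ultimately have nPU: "e \<notin> PU" "d \<notin> PU" .
  have SV: "SV = insert d SU" "SV = insert e PV"
    using square_union[OF cov(11,12) SU(1) PV(1) dd[symmetric] nPU] .
  have 1: "SV = insert e (insert (k, l) V)" "(k, l) \<notin> V" "e \<notin> V"
    using SV(2) PV(2) V nU U e(2) ed dd de by auto
  have 2: "SV = insert d (insert (i, j) S)" "(i, j) \<notin> S" "d \<notin> S"
    using SV(1) SU(2) S nP P d(2) ed dd de by auto
  have "hstep V SV k l \<or> vstep V SV k l" using E 1 youngs(7,9) unfolding hstep_def vstep_def by blast
  moreover have "hstep S SV i j \<or> vstep S SV i j" using D 2 youngs(3,9) unfolding hstep_def vstep_def by blast
  ultimately show ?thesis unfolding dstep_def by blast
qed

theorem domino_square:
  assumes "dstep X V" "dstep X S"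
  shows "domino_square X V S SV"
proof -
  interpret t: four_squares X U V P PU PV S SU SV by (rule transposed)
  obtain i j where D: "hstep X V i j \<or> vstep X V i j" using assms(1) by (auto simp: dstep_def)
  obtain k l where E: "hstep X S k l \<or> vstep X S k l" using assms(2) by (auto simp: dstep_def)
  have same: "S = V" if "hstep X V i j \<and> hstep X S i j \<or> vstep X V i j \<and> vstep X S i j"
    using that by (auto simp: hstep_def vstep_def)
  have "dstep V SV \<and> dstep S SV"
  proof (cases "(i, j) = (k, l)")
    case False
    show ?thesis using disjoint_corners[OF _ _ False] D E by metis
  next
    case True
    then consider "hstep X V i j" "hstep X S i j" | "vstep X V i j" "vstep X S i j"
      | "hstep X V i j" "vstep X S i j" | "vstep X V i j" "hstep X S i j" using D E by auto
    then show ?thesis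
    proof cases
      case 1 then show ?thesis using both_horizontal[OF 1] same by (auto simp: dstep_def)
    next
      case 2 then show ?thesis using both_vertical[OF 2] same by (auto simp: dstep_def)
    next
      case 3 then show ?thesis using horizontal_vertical[OF 3] by (auto simp: dstep_def)
    next
      case 4 then show ?thesis using t.horizontal_vertical[OF 4(2,1)] by (auto simp: dstep_def)
    qed
  qed
  moreover have "\<exists>l. hstep V SV (Suc i) l" if "hstep X V i j" "S = V" for i j
    using both_horizontal that by simp
  moreover have "\<exists>l. vstep V SV l (Suc j)" if "vstep X V i j" "S = V" for i j
    using both_vertical that by simp
  moreover have "SV = insert (Suc i, Suc j) (V \<union> S)"
    if "hstep X V i j \<and> vstep X S i j \<or> vstep X V i j \<and> hstep X S i j" for i j
    using that horizontal_vertical(3)[of i j] t.horizontal_vertical(3)[of i j] by (auto simp: Un_commute)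
  ultimately show ?thesis using assms unfolding domino_square_def by blast
qed

end

section \<open>Black cells\<close>

text \<open>Indices start at 0 here, so a row of even index starts with a black cell and has the
  rounded-up half of its cells black; these are the odd rows of \<open>part_ev\<close>.\<close>

definition black :: "(nat \<times> nat) set \<Rightarrow> (nat \<times> nat) set" where
  "black X = {c \<in> X. even (fst c + snd c)}"

lemma black_insert: "black (insert c X) = (if even (fst c + snd c) then insert c (black X) else black X)"
  by (auto simp: black_def)

lemma black_mono: "X \<subseteq> Y \<Longrightarrow> black X \<subseteq> black Y"
  by (auto simp: black_def)

lemma mem_black: "(i, j) \<in> black X \<longleftrightarrow> (i, j) \<in> X \<and> even (i + j)"
  by (auto simp: black_def)

definition black_in_row where
  "black_in_row r U Z \<longleftrightarrow> young Z \<and> (\<exists>l. (r, l) \<notin> black U \<and> black Z = insert (r, l) (black U))"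

definition black_in_col where
  "black_in_col c U Z \<longleftrightarrow> young Z \<and> (\<exists>l. (l, c) \<notin> black U \<and> black Z = insert (l, c) (black U))"

lemma hstep_black_in_row: "hstep U Z r l \<Longrightarrow> black_in_row r U Z"
  by (auto simp: hstep_def black_in_row_def black_insert mem_black)

lemma vstep_black_in_col: "vstep U Z l c \<Longrightarrow> black_in_col c U Z"
  by (auto simp: vstep_def black_in_col_def black_insert mem_black)

text \<open>In a Young diagram the black cells of a row are filled from the left, so knowing the row
  of the new black cell determines the cell.\<close>

lemma black_in_row_unique:
  assumes "black_in_row r U Z" "black_in_row r U' Z'" "black U = black U'"
  shows "black Z = black Z'"
proof -
  obtain l where l: "young Z" "(r, l) \<notin> black U" "black Z = insert (r, l) (black U)"
    using assms(1) by (auto simp: black_in_row_def)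
  obtain l' where l': "young Z'" "(r, l') \<notin> black U" "black Z' = insert (r, l') (black U)"
    using assms(2,3) by (auto simp: black_in_row_def)
  have m: "(r, l) \<in> Z" "(r, l') \<in> Z'" "even (r + l)" "even (r + l')"
    using l(3) l'(3) mem_black by blast+
  have "l = l'"
  proof (cases l l' rule: linorder_cases)
    case less
    then have "(r, l) \<in> black Z'" using youngD[OF l'(1) m(2)] m by (simp add: mem_black)
    then show ?thesis using l'(3) l(2) by auto
  next
    case greater
    then have "(r, l') \<in> black Z" using youngD[OF l(1) m(1)] m by (simp add: mem_black)
    then show ?thesis using l(3) l'(2) by auto
  qed
  then show ?thesis using l l' by simp
qed

lemma black_in_col_unique:
  assumes "black_in_col c U Z" "black_in_col c U' Z'" "black U = black U'"
  shows "black Z = black Z'"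
proof -
  obtain l where l: "young Z" "(l, c) \<notin> black U" "black Z = insert (l, c) (black U)"
    using assms(1) by (auto simp: black_in_col_def)
  obtain l' where l': "young Z'" "(l', c) \<notin> black U" "black Z' = insert (l', c) (black U)"
    using assms(2,3) by (auto simp: black_in_col_def)
  have m: "(l, c) \<in> Z" "(l', c) \<in> Z'" "even (l + c)" "even (l' + c)"
    using l(3) l'(3) mem_black by blast+
  have "l = l'"
  proof (cases l l' rule: linorder_cases)
    case less
    then have "(l, c) \<in> black Z'" using youngD[OF l'(1) m(2)] m by (simp add: mem_black)
    then show ?thesis using l'(3) l(2) by auto
  next
    case greater
    then have "(l', c) \<in> black Z" using youngD[OF l(1) m(1)] m by (simp add: mem_black)
    then show ?thesis using l(3) l'(2) by auto
  qed
  then show ?thesis using l l' by simp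
qed

lemma dstep_young: "dstep X U \<Longrightarrow> young X \<and> young U \<and> X \<subseteq> U"
  by (auto simp: dstep_def hstep_def vstep_def)

lemma dstep_black:
  assumes "dstep X U"
  obtains i j where "(i, j) \<notin> X" "even (i + j)" "black U = insert (i, j) (black X)"
proof -
  obtain i j where ij: "hstep X U i j \<or> vstep X U i j" using assms by (auto simp: dstep_def)
  then show thesis
  proof
    assume h: "hstep X U i j"
    then show thesis using that[of i j] that[of i "Suc j"]
      by (cases "even (i + j)") (auto simp: hstep_def black_insert)
  next
    assume h: "vstep X U i j"
    then show thesis using that[of i j] that[of "Suc i" j]
      by (cases "even (i + j)") (auto simp: vstep_def black_insert)
  qed
qed

text \<open>The case names tell where the white cell of the domino lies, seen from its black cell
  \<open>(i, j)\<close>.\<close>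

lemma dstep_cases:
  assumes "dstep X U" "(i, j) \<notin> X" "black U = insert (i, j) (black X)"
  obtains (left) j' where "j = Suc j'" "hstep X U i j'" | (right) "hstep X U i j"
    | (up) i' where "i = Suc i'" "vstep X U i' j" | (down) "vstep X U i j"
proof -
  have n: "(i, j) \<notin> black X" using assms(2) by (simp add: mem_black)
  obtain a b where ab: "hstep X U a b \<or> vstep X U a b" using assms by (auto simp: dstep_def)
  then show thesis
  proof
    assume h: "hstep X U a b"
    then have "black U = insert (if even (a + b) then (a, b) else (a, Suc b)) (black X)"
      by (auto simp: hstep_def black_insert)
    then have "(i, j) = (if even (a + b) then (a, b) else (a, Suc b))" using n assms(3) by blast
    then show thesis using h left right by (auto split: if_splits)
  next
    assume h: "vstep X U a b"
    then have "black U = insert (if even (a + b) then (a, b) else (Suc a, b)) (black X)"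
      by (auto simp: vstep_def black_insert)
    then have "(i, j) = (if even (a + b) then (a, b) else (Suc a, b))" using n assms(3) by blast
    then show thesis using h up down by (auto split: if_splits)
  qed
qed

text \<open>If the white cell lies left of or above the black one, it is missing from
  \<open>X\<close>, whereas every other position of a domino with this black cell needs it in
  \<open>X\<close>. So the two dominoes are equal, or they are \<open>right\<close> against
  \<open>down\<close>, which cross and give the block.\<close>

lemma domino_square_cases:
  assumes sq: "domino_square X U V Z" and n: "(i, j) \<notin> X"
    and bU: "black U = insert (i, j) (black X)" and bV: "black V = insert (i, j) (black X)"
  obtains (left) j' l where "j = Suc j'" "hstep X U i j'" "hstep U Z (Suc i) l"
    | (right) l where "hstep X U i j" "hstep U Z (Suc i) l"
    | (up) i' l where "i = Suc i'" "vstep X U i' j" "vstep U Z l (Suc j)"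
    | (down) l where "vstep X U i j" "vstep U Z l (Suc j)"
    | (diag) "black Z = insert (Suc i, Suc j) (black U)"
proof -
  have dU: "dstep X U" and dV: "dstep X V" using sq by (auto simp: domino_square_def)
  have H: "\<exists>l. hstep U Z (Suc i) l" if "hstep X U i j" "V = U" for i j
    using sq that by (auto simp: domino_square_def)
  have W: "\<exists>l. vstep U Z l (Suc j)" if "vstep X U i j" "V = U" for i j
    using sq that by (auto simp: domino_square_def)
  have D: "black Z = insert (Suc i, Suc j) (black U)"
    if "hstep X U i j \<and> vstep X V i j \<or> vstep X U i j \<and> hstep X V i j"
  proof -
    have "Z = insert (Suc i, Suc j) (U \<union> V)" using sq that unfolding domino_square_def by blast
    moreover have "black (U \<union> V) = black U" using bU bV by (auto simp: black_def)
    moreover have "even (i + j)" using bU mem_black[of i j U] by blast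
    ultimately show ?thesis by (simp add: black_insert)
  qed
  have hU: "V = U" if "hstep X U a b" "hstep X V a b" for a b using that by (simp add: hstep_def)
  have vU: "V = U" if "vstep X U a b" "vstep X V a b" for a b using that by (simp add: vstep_def)
  from dU n bU show thesis
  proof (cases rule: dstep_cases)
    case U: (left j')
    have x: "(i, j') \<notin> X" using U(2) by (simp add: hstep_def)
    from dV n bV have "hstep X V i j'"
    proof (cases rule: dstep_cases)
      case (left j2) then show ?thesis using U by simp
    next
      case right then show ?thesis using hstep_cells(1)[OF right, of j'] x U by simp
    next
      case (up i') then show ?thesis using vstep_cells(3)[OF up(2), of j'] x U by simp
    next
      case down then show ?thesis using vstep_cells(2)[OF down, of j'] x U by simp
    qed
    then show thesis using hU[OF U(2)] H[OF U(2)] U that(1) by blast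
  next
    case U: (up i')
    have x: "(i', j) \<notin> X" using U(2) by (simp add: vstep_def)
    from dV n bV have "vstep X V i' j"
    proof (cases rule: dstep_cases)
      case (up i2) then show ?thesis using U by simp
    next
      case right then show ?thesis using hstep_cells(2)[OF right, of i'] x U by simp
    next
      case (left j') then show ?thesis using hstep_cells(3)[OF left(2), of i'] x U by simp
    next
      case down then show ?thesis using vstep_cells(1)[OF down, of i'] x U by simp
    qed
    then show thesis using vU[OF U(2)] W[OF U(2)] U that(3) by blast
  next
    case U: right
    from dV n bV show thesis
    proof (cases rule: dstep_cases)
      case right then show thesis using hU[OF U] H[OF U] U that(2) by blast
    next
      case down then show thesis using D U that(5) by blast
    next
      case (left j') then show thesis using hstep_cells(1)[OF U, of j'] by (simp add: hstep_def)
    next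
      case (up i') then show thesis using hstep_cells(2)[OF U, of i'] by (simp add: vstep_def)
    qed
  next
    case U: down
    from dV n bV show thesis
    proof (cases rule: dstep_cases)
      case down then show thesis using vU[OF U] W[OF U] U that(4) by blast
    next
      case right then show thesis using D U that(5) by blast
    next
      case (left j') then show thesis using vstep_cells(2)[OF U, of j'] by (simp add: hstep_def)
    next
      case (up i') then show thesis using vstep_cells(1)[OF U, of i'] by (simp add: vstep_def)
    qed
  qed
qed

text \<open>
  The only configuration in which the growth rules would separate the black cells; it is excluded by
  comparing the number of cells in the first rows.
\<close>

lemma left_up_top_rows:
  assumes "hstep X U (Suc i) j" "hstep U Z (Suc (Suc i)) l"
    and "vstep X' U' i (Suc j)" "vstep U' Z' l' (Suc (Suc j))"
  shows "top_rows (Suc i) Z = top_rows (Suc i) X" "top_rows (Suc i) X' + 2 \<le> top_rows (Suc i) Z'"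
proof -
  have 1: "finite X" "finite U" "finite X'" "finite U'" "finite Z'"
    using assms young_finite by (auto simp: hstep_def vstep_def)
  show "top_rows (Suc i) Z = top_rows (Suc i) X"
    using assms(1,2) 1 by (simp add: hstep_def top_rows_insert)
  have "(i, Suc (Suc j)) \<notin> U'"
    using vstep_cells(2)[OF assms(3), of "Suc (Suc j)"] assms(3) by (simp add: vstep_def)
  \<comment> \<open>Column \<open>Suc (Suc j)\<close> of \<open>U'\<close> has height
    \<open>l'\<close> and misses row \<open>i\<close>. Hence the second vertical domino also meets
    the first \<open>Suc i\<close> rows, which gain two cells in all, against none on the horizontal
    side.\<close>
  then have "l' \<le> i" using vstep_cells(1)[OF assms(4), of i] by simp
  then show "top_rows (Suc i) X' + 2 \<le> top_rows (Suc i) Z'"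
    using assms(3,4) 1 by (simp add: vstep_def top_rows_insert)
qed

text \<open>The two sides lend each other support through their common black cells. The cell left of
  \<open>(Suc i, j)\<close> is black and lies in \<open>X'\<close>, where the vertical domino fits,
  hence also in \<open>X\<close>; so the next horizontal domino cannot start before column
  \<open>j\<close>. The cell above \<open>(i, Suc j)\<close> does the same for the vertical
  side.\<close>

lemma right_down_black:
  assumes R: "hstep X U i j" "hstep U Z (Suc i) l" and D: "vstep X' U' i j" "vstep U' Z' l' (Suc j)"
    and b: "black X = black X'" and e: "even (i + j)"
  shows "black Z = insert (Suc i, Suc j) (black U)" "black Z' = insert (Suc i, Suc j) (black U')"
proof -
  have y: "young Z" "young Z'" using R D by (auto simp: hstep_def vstep_def)
  have U: "U = insert (i, Suc j) (insert (i, j) X)" and Z: "Z = insert (Suc i, Suc l) (insert (Suc i, l) U)"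
    and U': "U' = insert (Suc i, j) (insert (i, j) X')" and Z': "Z' = insert (Suc l', Suc j) (insert (l', Suc j) U')"
    using R D by (simp_all add: hstep_def vstep_def)
  have "j \<le> l"
  proof (cases j)
    case (Suc j')
    then have "(Suc i, j') \<in> X'" using vstep_cells(3)[OF D(1), of j'] by simp
    then have "(Suc i, j') \<in> black X" using b e Suc mem_black[of "Suc i" j' X'] by simp
    then have "(Suc i, j') \<in> U" using U by (simp add: mem_black)
    then show ?thesis using hstep_cells(1)[OF R(2), of j'] Suc by simp
  qed simp
  moreover have "(i, Suc l) \<in> Z" using youngD[OF y(1), of "Suc i" "Suc l" i "Suc l"] Z by simp
  then have "(i, Suc l) \<in> U" using Z by simp
  then have "l \<le> j" using U hstep_cells(1)[OF R(1), of "Suc l"] by auto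
  ultimately have "l = j" by simp
  then show "black Z = insert (Suc i, Suc j) (black U)" using Z e by (simp add: black_insert)
  have "i \<le> l'"
  proof (cases i)
    case (Suc i')
    then have "(i', Suc j) \<in> X" using hstep_cells(3)[OF R(1), of i'] by simp
    then have "(i', Suc j) \<in> black X'" using b e Suc mem_black[of i' "Suc j" X] by simp
    then have "(i', Suc j) \<in> U'" using U' by (simp add: mem_black)
    then show ?thesis using vstep_cells(1)[OF D(2), of i'] Suc by simp
  qed simp
  moreover have "(Suc l', j) \<in> Z'" using youngD[OF y(2), of "Suc l'" "Suc j" "Suc l'" j] Z' by simp
  then have "(Suc l', j) \<in> U'" using Z' by simp
  then have "l' \<le> i" using U' vstep_cells(1)[OF D(1), of "Suc l'"] by auto
  ultimately have "l' = i" by simp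
  then show "black Z' = insert (Suc i, Suc j) (black U')" using Z' e by (simp add: black_insert)
qed

text \<open>The cell \<open>(Suc i, j)\<close> is black and supports the vertical domino from the
  left, so it lies in \<open>X'\<close> and therefore in \<open>X\<close>; but \<open>X\<close>
  lacks the cell above it.\<close>

lemma left_down_impossible:
  assumes "hstep X U i j" "vstep X' U' i (Suc j)" "black X = black X'" "even (i + Suc j)"
  shows False
proof -
  have "(Suc i, j) \<in> X'" using vstep_cells(3)[OF assms(2), of j] by simp
  then have "(Suc i, j) \<in> X" using assms(3,4) mem_black[of "Suc i" j X] mem_black[of "Suc i" j X'] by simp
  then have "(i, j) \<in> X" using youngD[of X "Suc i" j i j] assms(1) by (simp add: hstep_def)
  then show False using assms(1) by (simp add: hstep_def)
qed

lemma right_up_impossible: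
  assumes "hstep X U (Suc i) j" "vstep X' U' i j" "black X = black X'" "even (Suc i + j)"
  shows False
proof -
  have "(i, Suc j) \<in> X" using hstep_cells(3)[OF assms(1), of i] by simp
  then have "(i, Suc j) \<in> X'" using assms(3,4) mem_black[of i "Suc j" X] mem_black[of i "Suc j" X'] by simp
  then have "(i, j) \<in> X'" using youngD[of X' i "Suc j" i j] assms(2) by (simp add: vstep_def)
  then show False using assms(2) by (simp add: vstep_def)
qed

text \<open>Outcomes that name the same row or column agree by uniqueness, and \<open>diag\<close>
  fits both kinds. Of the mixed pairs, \<open>right\<close> against \<open>down\<close> reaches the
  same cell, \<open>left\<close> against \<open>down\<close> and \<open>right\<close> against
  \<open>up\<close> cannot occur, and \<open>left\<close> against \<open>up\<close> contradicts
  \<open>top\<close>.\<close>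

theorem domino_square_black:
  assumes sq: "domino_square X U V Z" and sq': "domino_square X' U' V' Z'"
    and bX: "black X = black X'" and bU: "black U = black U'" and bV: "black V = black V'"
    and top: "\<And>k. \<bar>(int (top_rows k Z) - int (top_rows k Z')) - (int (top_rows k X) - int (top_rows k X'))\<bar> \<le> 1"
  shows "black Z = black Z'"
proof -
  have ds: "dstep X U" "dstep X V" "dstep U Z" "dstep V Z" using sq by (auto simp: domino_square_def)
  have ds': "dstep X' U'" "dstep X' V'" "dstep U' Z'" "dstep V' Z'" using sq' by (auto simp: domino_square_def)
  obtain i j where ij: "(i, j) \<notin> X" "even (i + j)" "black U = insert (i, j) (black X)" using dstep_black[OF ds(1)] .
  obtain k l where kl: "(k, l) \<notin> X" "even (k + l)" "black V = insert (k, l) (black X)" using dstep_black[OF ds(2)] .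
  have nX': "(i, j) \<notin> X'" using ij(1,2) bX mem_black[of i j X] mem_black[of i j X'] by simp
  show ?thesis
  proof (cases "(i, j) = (k, l)")
    case False
    \<comment> \<open>\<open>Z\<close> has just one black cell more than \<open>U\<close>, and it
      must contain the black cell contributed by \<open>V\<close>.\<close>
    have union: "black Z = insert (k, l) (black U)"
      if t: "dstep U Z" "dstep V Z" "(k, l) \<in> black V" "(k, l) \<notin> black U" for U V Z
    proof -
      obtain a b where ab: "black Z = insert (a, b) (black U)" using dstep_black[OF t(1)] .
      have "(k, l) \<in> black Z" using black_mono dstep_young[OF that(2)] that(3) by blast
      then show ?thesis using ab that(4) by auto
    qed
    have m: "(k, l) \<in> black V" "(k, l) \<notin> black U" using kl ij False by (auto simp: mem_black)
    show ?thesis using union[OF ds(3,4) m] union[OF ds'(3,4) m[unfolded bU bV]] bU by simp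
  next
    case True
    then have V: "black V = insert (i, j) (black X)" using kl by simp
    have U': "black U' = insert (i, j) (black X')" "black V' = insert (i, j) (black X')"
      using ij(3) V bU bV bX by simp_all
    \<comment> \<open>The block's new black cell lies in row \<open>Suc i\<close> and in column
      \<open>Suc j\<close> at once, so it can be compared with horizontal and with vertical
      outcomes.\<close>
    have diag: "black_in_row (Suc i) U Z \<and> black_in_col (Suc j) U Z"
      if "black Z = insert (Suc i, Suc j) (black U)" "dstep U Z" "young X" "(i, j) \<notin> X" "black U = insert (i, j) (black X)"
      for U Z X
    proof -
      have "(Suc i, Suc j) \<notin> black X" using youngD[OF that(3), of "Suc i" "Suc j" i j] that(4) by (auto simp: mem_black)
      then have "(Suc i, Suc j) \<notin> black U" using that(5) by auto
      then show ?thesis using that(1) dstep_young[OF that(2)] unfolding black_in_row_def black_in_col_def by blast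
    qed
    have d: "black_in_row (Suc i) U Z \<and> black_in_col (Suc j) U Z" if "black Z = insert (Suc i, Suc j) (black U)"
      using diag[OF that ds(3)] dstep_young[OF ds(1)] ij by blast
    have d': "black_in_row (Suc i) U' Z' \<and> black_in_col (Suc j) U' Z'" if "black Z' = insert (Suc i, Suc j) (black U')"
      using diag[OF that ds'(3)] dstep_young[OF ds'(1)] nX' U' by blast
    note row = black_in_row_unique[OF _ _ bU, of "Suc i"] and col = black_in_col_unique[OF _ _ bU, of "Suc j"]
    note hr = hstep_black_in_row and vc = vstep_black_in_col
    from sq ij(1,3) V show ?thesis
    proof (cases rule: domino_square_cases)
      case L: (left j1 l1)
      from sq' nX' U' show ?thesis
      proof (cases rule: domino_square_cases)
        case (left j2 l2) then show ?thesis using row hr L by blast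
      next
        case (right l2) then show ?thesis using row hr L by blast
      next
        case Up: (up i2 l2)
        have "top_rows i Z = top_rows i X" "top_rows i X' + 2 \<le> top_rows i Z'"
          using left_up_top_rows[of X U i2 j1 Z l1 X' U' Z' l2] L Up by simp_all
        then show ?thesis using top[of i] by linarith
      next
        case (down l2)
        then show ?thesis using left_down_impossible[of X U i j1 X' U'] L bX ij(2) by simp
      next
        case diag then show ?thesis using d' row hr L by blast
      qed
    next
      case R: (right l1)
      from sq' nX' U' show ?thesis
      proof (cases rule: domino_square_cases)
        case (left j2 l2) then show ?thesis using row hr R by blast
      next
        case (right l2) then show ?thesis using row hr R by blast
      next
        case Up: (up i2 l2)
        then show ?thesis using right_up_impossible[of X U i2 j X' U'] R bX ij(2) by simp
      next
        case (down l2)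
        then show ?thesis using right_down_black[OF R down bX ij(2)] bU by simp
      next
        case diag then show ?thesis using d' row hr R by blast
      qed
    next
      case Up: (up i1 l1)
      from sq' nX' U' show ?thesis
      proof (cases rule: domino_square_cases)
        case L: (left j2 l2)
        have "top_rows i Z' = top_rows i X'" "top_rows i X + 2 \<le> top_rows i Z"
          using left_up_top_rows[of X' U' i1 j2 Z' l2 X U Z l1] L Up by simp_all
        then show ?thesis using top[of i] by linarith
      next
        case (right l2)
        then show ?thesis using right_up_impossible[of X' U' i1 j X U] Up bX ij(2) by simp
      next
        case (up i2 l2) then show ?thesis using col vc Up by blast
      next
        case (down l2) then show ?thesis using col vc Up by blast
      next
        case diag then show ?thesis using d' col vc Up by blast
      qed
    next
      case D: (down l1)
      from sq' nX' U' show ?thesis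
      proof (cases rule: domino_square_cases)
        case (left j2 l2)
        then show ?thesis using left_down_impossible[of X' U' i j2 X U] D bX ij(2) by simp
      next
        case (right l2)
        then show ?thesis using right_down_black[OF right D bX[symmetric] ij(2)] bU by simp
      next
        case (up i2 l2) then show ?thesis using col vc D by blast
      next
        case (down l2) then show ?thesis using col vc D by blast
      next
        case diag then show ?thesis using d' col vc D by blast
      qed
    next
      case diag
      note dd = d[OF diag]
      from sq' nX' U' show ?thesis
      proof (cases rule: domino_square_cases)
        case (left j2 l2) then show ?thesis using row hr dd by blast
      next
        case (right l2) then show ?thesis using row hr dd by blast
      next
        case (up i2 l2) then show ?thesis using col vc dd by blast
      next
        case (down l2) then show ?thesis using col vc dd by blast
      next
        case diag then show ?thesis using d' row dd by blast
      qed
    qed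
  qed
qed

section \<open>Signed permutations\<close>

definition extreme :: "int \<times> int \<Rightarrow> (int \<times> int) set \<Rightarrow> bool" where
  "extreme p A \<longleftrightarrow> (\<forall>z\<in>A. fst z < fst p) \<or> (\<forall>z\<in>A. fst p < fst z) \<or>
     (\<forall>z\<in>A. snd z < snd p) \<or> (\<forall>z\<in>A. snd p < snd z)"

lemma covers_insert:
  assumes "generic (insert p A)" "extreme p A"
  shows "covers (shape A) (shape (insert p A))"
  using assms shape_insert_right[of p A] shape_insert_left[of p A] shape_insert_top[of p A]
    shape_insert_bottom[of p A] young_shape generic_subset[OF assms(1) subset_insertI]
  unfolding covers_def extreme_def by blast

lemma covers_squareI:
  assumes g: "generic (insert p (insert q A))" and p: "extreme p (insert q A)" and q: "extreme q (insert p A)"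
  shows "covers (shape A) (shape (insert p A))" "covers (shape A) (shape (insert q A))"
    "covers (shape (insert p A)) (shape (insert p (insert q A)))"
    "covers (shape (insert q A)) (shape (insert p (insert q A)))"
proof -
  have "extreme p A" "extreme q A" using p q by (auto simp: extreme_def)
  moreover have "generic (insert p A)" "generic (insert q A)" "generic (insert q (insert p A))"
    using generic_subset[OF g] g by (blast, blast, simp add: insert_commute)
  ultimately show "covers (shape A) (shape (insert p A))" "covers (shape A) (shape (insert q A))"
    "covers (shape (insert p A)) (shape (insert p (insert q A)))"
    "covers (shape (insert q A)) (shape (insert p (insert q A)))"
    using covers_insert g p q insert_commute[of p q A] by metis+
qed

lemma row_square_points:
  assumes g: "generic (insert p (insert q A))"
    and pq: "(\<forall>z\<in>insert q A. fst z < fst p) \<and> (\<forall>z\<in>insert p A. snd z < snd q) \<or>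
      (\<forall>z\<in>insert q A. fst p < fst z) \<and> (\<forall>z\<in>insert p A. snd q < snd z)"
  shows "row_square (shape A) (shape (insert p A)) (shape (insert q A)) (shape (insert p (insert q A)))"
proof -
  have "extreme p (insert q A)" "extreme q (insert p A)" using pq unfolding extreme_def by blast+
  then show ?thesis
    using covers_squareI[OF g] shape_insert_right_top[OF g] shape_insert_left_bottom[OF g] pq
    unfolding row_square_def by blast
qed

lemma col_square_points:
  assumes g: "generic (insert p (insert q A))"
    and pq: "(\<forall>z\<in>insert q A. fst z < fst p) \<and> (\<forall>z\<in>insert p A. snd q < snd z) \<or>
      (\<forall>z\<in>insert q A. fst p < fst z) \<and> (\<forall>z\<in>insert p A. snd z < snd q)"
  shows "col_square (shape A) (shape (insert p A)) (shape (insert q A)) (shape (insert p (insert q A)))"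
proof -
  have "extreme p (insert q A)" "extreme q (insert p A)" using pq unfolding extreme_def by blast+
  then show ?thesis
    using covers_squareI[OF g] shape_insert_right_bottom[OF g] shape_insert_left_top[OF g] pq
    unfolding col_square_def by blast
qed

lemma four_squares_points:
  assumes g: "generic (insert p (insert p' (insert q (insert q' A))))"
    and pr: "\<forall>z\<in>insert p' (insert q (insert q' A)). fst z < fst p"
    and pl: "\<forall>z\<in>insert p (insert q (insert q' A)). fst p' < fst z"
    and qt: "\<forall>z\<in>insert q' (insert p (insert p' A)). snd z < snd q"
    and qb: "\<forall>z\<in>insert q (insert p (insert p' A)). snd q' < snd z"
  shows "four_squares (shape A) (shape (insert p A)) (shape (insert p' (insert p A)))
     (shape (insert q A)) (shape (insert p (insert q A))) (shape (insert p' (insert p (insert q A))))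
     (shape (insert q' (insert q A))) (shape (insert p (insert q' (insert q A))))
     (shape (insert p' (insert p (insert q' (insert q A)))))"
proof
  show "row_square (shape A) (shape (insert p A)) (shape (insert q A)) (shape (insert p (insert q A)))"
    by (rule row_square_points, rule generic_subset[OF g], blast) (use pr qt in auto)
  show "col_square (shape (insert q A)) (shape (insert p (insert q A))) (shape (insert q' (insert q A)))
     (shape (insert p (insert q' (insert q A))))"
    by (rule col_square_points, rule generic_subset[OF g], blast) (use pr qb in auto)
  have "col_square (shape (insert p A)) (shape (insert p' (insert p A))) (shape (insert q (insert p A)))
     (shape (insert p' (insert q (insert p A))))"
    by (rule col_square_points, rule generic_subset[OF g], blast) (use pl qt in auto)
  then show "col_square (shape (insert p A)) (shape (insert p' (insert p A))) (shape (insert p (insert q A)))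
     (shape (insert p' (insert p (insert q A))))"
    by (simp add: insert_commute)
  have "row_square (shape (insert p (insert q A))) (shape (insert p' (insert p (insert q A))))
      (shape (insert q' (insert p (insert q A)))) (shape (insert p' (insert q' (insert p (insert q A)))))"
    by (rule row_square_points, rule generic_subset[OF g], blast) (use pl qb in auto)
  then show "row_square (shape (insert p (insert q A))) (shape (insert p' (insert p (insert q A))))
      (shape (insert p (insert q' (insert q A)))) (shape (insert p' (insert p (insert q' (insert q A)))))"
    by (simp add: insert_commute)
qed

text \<open>Both points are extreme corners on the increasing diagonal, so each lengthens row 0;
  successive cells of one row are adjacent.\<close>

lemma hstep_corner:
  assumes g: "generic (insert p' (insert p A))"
    and p: "\<forall>z\<in>insert p' A. fst z < fst p \<and> snd z < snd p" and p': "\<forall>z\<in>insert p A. fst p' < fst z \<and> snd p' < snd z"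
  shows "\<exists>l. hstep (shape A) (shape (insert p' (insert p A))) 0 l"
proof -
  have g': "generic (insert p A)" "generic A" using generic_subset[OF g] by blast+
  obtain j where j: "(0, j) \<notin> shape A" "shape (insert p A) = insert (0, j) (shape A)"
    using shape_insert_corner_right_top[OF g'(1)] p by auto
  obtain k where k: "(0, k) \<notin> shape (insert p A)" "shape (insert p' (insert p A)) = insert (0, k) (shape (insert p A))"
    using shape_insert_corner_left_bottom[OF g p'] by auto
  have y: "young (shape A)" "young (shape (insert p A))" "young (shape (insert p' (insert p A)))"
    using young_shape g g' by blast+
  have 1: "(0, l) \<in> shape A \<longleftrightarrow> l < j" for l
    using young_new_cell(1)[OF y(1) _ j(1)] y(2) unfolding j(2) by blast
  have 2: "(0, l) \<in> shape (insert p A) \<longleftrightarrow> l < k" for l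
    using young_new_cell(1)[OF y(2) _ k(1)] y(3) unfolding k(2) by blast
  have "k = Suc j" using 1[of j] 1[of "Suc j"] 2[of j] 2[of "Suc j"] j(2) by auto
  then have "hstep (shape A) (shape (insert p' (insert p A))) 0 j"
    using j k y 1[of "Suc j"] by (simp add: hstep_def)
  then show ?thesis by blast
qed

lemma vstep_corner:
  assumes g: "generic (insert p' (insert p A))"
    and p: "\<forall>z\<in>insert p' A. fst z < fst p \<and> snd p < snd z" and p': "\<forall>z\<in>insert p A. fst p' < fst z \<and> snd z < snd p'"
  shows "\<exists>l. vstep (shape A) (shape (insert p' (insert p A))) l 0"
proof -
  have g': "generic (insert p A)" "generic A" using generic_subset[OF g] by blast+
  obtain j where j: "(j, 0) \<notin> shape A" "shape (insert p A) = insert (j, 0) (shape A)"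
    using shape_insert_corner_right_bottom[OF g'(1)] p by auto
  obtain k where k: "(k, 0) \<notin> shape (insert p A)" "shape (insert p' (insert p A)) = insert (k, 0) (shape (insert p A))"
    using shape_insert_corner_left_top[OF g p'] by auto
  have y: "young (shape A)" "young (shape (insert p A))" "young (shape (insert p' (insert p A)))"
    using young_shape g g' by blast+
  have 1: "(l, 0) \<in> shape A \<longleftrightarrow> l < j" for l
    using young_new_cell(2)[OF y(1) _ j(1)] y(2) unfolding j(2) by blast
  have 2: "(l, 0) \<in> shape (insert p A) \<longleftrightarrow> l < k" for l
    using young_new_cell(2)[OF y(2) _ k(1)] y(3) unfolding k(2) by blast
  have "k = Suc j" using 1[of j] 1[of "Suc j"] 2[of j] 2[of "Suc j"] j(2) by auto
  then have "vstep (shape A) (shape (insert p' (insert p A))) j 0"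
    using j k y 1[of "Suc j"] by (simp add: vstep_def)
  then show ?thesis by blast
qed

section \<open>Signed permutations as centrally symmetric point sets\<close>

definition signed :: "(int \<Rightarrow> int) \<Rightarrow> bool" where
  "signed w \<longleftrightarrow> bij w \<and> (\<forall>i. w (- i) = - w i)"

lemma signed_minus: "signed w \<Longrightarrow> w (- i) = - w i"
  by (simp add: signed_def)

lemma signed_eq_iff: "signed w \<Longrightarrow> w i = w j \<longleftrightarrow> i = j"
  by (auto simp: signed_def bij_def inj_eq)

lemma signed_zero: "signed w \<Longrightarrow> w i = 0 \<longleftrightarrow> i = 0"
  using signed_minus[of w 0] signed_eq_iff[of w i 0] by simp

lemma signed_inv: "signed w \<Longrightarrow> signed (inv w)"
proof -
  assume w: "signed w"
  then have b: "bij w" by (simp add: signed_def)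
  have "inv w (- i) = - inv w i" for i
  proof -
    have "w (- inv w i) = - i" using signed_minus[OF w] b by (simp add: bij_def surj_f_inv_f)
    then show ?thesis using b by (metis bij_inv_eq_iff)
  qed
  then show ?thesis using b bij_imp_bij_inv by (auto simp: signed_def)
qed

lemma signed_inv_iff: "signed w \<Longrightarrow> inv w v = i \<longleftrightarrow> w i = v"
  by (metis bij_inv_eq_iff signed_def)

lemma signed_comp: "signed v \<Longrightarrow> signed w \<Longrightarrow> signed (v \<circ> w)"
  by (auto simp: signed_def bij_comp)

text \<open>The origin is on the graph of every signed map but is not a letter of the word, so it is
  left out. Width \<open>k\<close> and height \<open>m\<close> vary independently, which gives the
  grid of shapes on which the induction runs.\<close>

definition points :: "(int \<Rightarrow> int) \<Rightarrow> nat \<Rightarrow> nat \<Rightarrow> (int \<times> int) set" where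
  "points w k m = {(i, v). i \<noteq> 0 \<and> \<bar>i\<bar> \<le> int k \<and> \<bar>v\<bar> \<le> int m \<and> v = w i}"

lemma generic_points: "signed w \<Longrightarrow> generic (points w k m)"
proof -
  assume w: "signed w"
  have "points w k m \<subseteq> {- int k..int k} \<times> {- int m..int m}" by (auto simp: points_def)
  then have "finite (points w k m)" by (rule finite_subset) simp
  then show ?thesis using signed_eq_iff[OF w] by (auto simp: generic_def inj_on_def points_def)
qed

lemma shape_points_inv: "signed w \<Longrightarrow> shape (points (inv w) m k) = shape (points w k m)"
proof -
  assume w: "signed w"
  have "points (inv w) m k = prod.swap ` points w k m"
    using signed_inv_iff[OF w] signed_zero[OF w] signed_zero[OF signed_inv[OF w]]
    by (auto simp: points_def image_iff) metis+
  then show ?thesis using shape_swap[OF generic_points[OF w]] by simp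
qed

lemma points_Suc_right:
  assumes w: "signed w"
  shows "points w (Suc k) m = (if \<bar>w (int (Suc k))\<bar> \<le> int m
    then insert (- int (Suc k), - w (int (Suc k))) (insert (int (Suc k), w (int (Suc k))) (points w k m))
    else points w k m)"
proof -
  let ?K = "int (Suc k)"
  have m: "w (- ?K) = - w ?K" using signed_minus[OF w] .
  have "\<bar>i\<bar> \<le> ?K \<longleftrightarrow> \<bar>i\<bar> \<le> int k \<or> i = ?K \<or> i = - ?K" for i by auto
  then have "points w (Suc k) m = points w k m \<union> {(i, w i) |i. (i = ?K \<or> i = - ?K) \<and> \<bar>w i\<bar> \<le> int m}"
    unfolding points_def by auto
  also have "{(i, w i) |i. (i = ?K \<or> i = - ?K) \<and> \<bar>w i\<bar> \<le> int m} =
      (if \<bar>w ?K\<bar> \<le> int m then {(- ?K, - w ?K), (?K, w ?K)} else {})"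
    using m by auto
  finally show ?thesis by auto
qed

lemma points_Suc_top:
  assumes w: "signed w"
  shows "points w k (Suc m) = (if \<bar>inv w (int (Suc m))\<bar> \<le> int k
    then insert (- inv w (int (Suc m)), - int (Suc m)) (insert (inv w (int (Suc m)), int (Suc m)) (points w k m))
    else points w k m)"
proof -
  let ?M = "int (Suc m)" let ?i = "inv w ?M"
  have wi: "w ?i = ?M" using signed_inv_iff[OF w, of ?M ?i] by simp
  have wi': "w (- ?i) = - ?M" using signed_minus[OF w, of ?i] wi by simp
  have i0: "?i \<noteq> 0" using signed_zero[OF signed_inv[OF w], of ?M] by simp
  have "\<bar>v\<bar> \<le> ?M \<longleftrightarrow> \<bar>v\<bar> \<le> int m \<or> v = ?M \<or> v = - ?M" for v by auto
  moreover have "w i = ?M \<longleftrightarrow> i = ?i" "w i = - ?M \<longleftrightarrow> i = - ?i" for i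
    using wi wi' signed_eq_iff[OF w] by metis+
  ultimately have "\<bar>w i\<bar> \<le> ?M \<longleftrightarrow> \<bar>w i\<bar> \<le> int m \<or> i = ?i \<or> i = - ?i" for i by metis
  then have "points w k (Suc m) = points w k m \<union> {(i, w i) |i. (i = ?i \<or> i = - ?i) \<and> \<bar>i\<bar> \<le> int k}"
    unfolding points_def using i0 by auto
  also have "{(i, w i) |i. (i = ?i \<or> i = - ?i) \<and> \<bar>i\<bar> \<le> int k} =
      (if \<bar>?i\<bar> \<le> int k then {(- ?i, - ?M), (?i, ?M)} else {})"
    using wi wi' by auto
  finally show ?thesis by auto
qed

lemma points_bounds: "z \<in> points w k m \<Longrightarrow> \<bar>fst z\<bar> \<le> int k \<and> \<bar>snd z\<bar> \<le> int m"
  by (auto simp: points_def)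

text \<open>The bounds place the new column pair within height \<open>m\<close> and the new row pair
  within width \<open>k\<close>. So the four points are separate, and each is extreme in its own
  direction.\<close>

lemma points_four_squares:
  assumes w: "signed w" and p: "\<bar>w (int (Suc k))\<bar> \<le> int m" and q: "\<bar>inv w (int (Suc m))\<bar> \<le> int k"
  shows "\<exists>P U PU SU PV. four_squares (shape (points w k m)) P (shape (points w (Suc k) m)) U PU SU
     (shape (points w k (Suc m))) PV (shape (points w (Suc k) (Suc m)))"
proof -
  let ?K = "int (Suc k)" and ?M = "int (Suc m)" and ?A = "points w k m"
  let ?p = "(?K, w ?K)" and ?p' = "(- ?K, - w ?K)" and ?q = "(inv w ?M, ?M)" and ?q' = "(- inv w ?M, - ?M)"
  have p2: "\<bar>w ?K\<bar> \<le> int (Suc m)" using p by simp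
  have 1: "points w (Suc k) m = insert ?p' (insert ?p ?A)" using points_Suc_right[OF w, of k m] p by simp
  have 2: "points w k (Suc m) = insert ?q' (insert ?q ?A)" using points_Suc_top[OF w, of k m] q by simp
  have 3: "points w (Suc k) (Suc m) = insert ?p' (insert ?p (insert ?q' (insert ?q ?A)))"
    using points_Suc_right[OF w, of k "Suc m"] p2 2 by simp
  have "generic (points w (Suc k) (Suc m))" using generic_points[OF w] .
  then have "generic (insert ?p (insert ?p' (insert ?q (insert ?q' ?A))))"
    unfolding 3 by (simp add: insert_commute)
  then show ?thesis unfolding 1 2 3
    using four_squares_points[of ?p ?p' ?q ?q' ?A] points_bounds[of _ w k m] p q by fastforce
qed

lemma points_corner:
  assumes w: "signed w" and p: "\<bar>w (int (Suc k))\<bar> = int (Suc m)"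
  shows "points w k (Suc m) = points w k m" "points w (Suc k) m = points w k m"
    "w (int (Suc k)) = int (Suc m) \<Longrightarrow> \<exists>l. hstep (shape (points w k m)) (shape (points w (Suc k) (Suc m))) 0 l"
    "w (int (Suc k)) = - int (Suc m) \<Longrightarrow> \<exists>l. vstep (shape (points w k m)) (shape (points w (Suc k) (Suc m))) l 0"
proof -
  let ?K = "int (Suc k)" and ?M = "int (Suc m)" and ?A = "points w k m"
  have "inv w ?M = ?K \<or> inv w ?M = - ?K"
    using p signed_inv_iff[OF w] signed_minus[OF w, of ?K] by (auto simp: abs_if split: if_splits)
  then have "\<bar>inv w ?M\<bar> = ?K" by auto
  then show 1: "points w k (Suc m) = points w k m" using points_Suc_top[OF w, of k m] by simp
  show "points w (Suc k) m = points w k m" using points_Suc_right[OF w, of k m] p by simp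
  have 2: "points w (Suc k) (Suc m) = insert (- ?K, - w ?K) (insert (?K, w ?K) ?A)"
    using points_Suc_right[OF w, of k "Suc m"] p 1 by simp
  have g: "generic (insert (- ?K, - w ?K) (insert (?K, w ?K) ?A))"
    using generic_points[OF w, of "Suc k" "Suc m"] 2 by simp
  have b: "\<bar>fst z\<bar> \<le> int k" "\<bar>snd z\<bar> \<le> int m" if "z \<in> ?A" for z using points_bounds[OF that] by auto
  show "\<exists>l. hstep (shape ?A) (shape (points w (Suc k) (Suc m))) 0 l" if "w ?K = ?M"
    unfolding 2 by (rule hstep_corner[OF g]) (use that b in \<open>force+\<close>)
  show "\<exists>l. vstep (shape ?A) (shape (points w (Suc k) (Suc m))) l 0" if "w ?K = - ?M"
    unfolding 2 by (rule vstep_corner[OF g]) (use that b in \<open>force+\<close>)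
qed

text \<open>For a single extension the domino property is not visible. It starts at the height where
  the new pair sits in corners of the box, so that both cells go to the first row or to the first
  column, and is then carried to larger \<open>m\<close> by the local squares.\<close>

lemma dstep_points:
  assumes "signed w" "\<bar>w (int (Suc k))\<bar> \<le> int m"
  shows "dstep (shape (points w k m)) (shape (points w (Suc k) m))"
  using assms
proof (induction "k + m" arbitrary: w k m rule: less_induct)
  case less
  note w = less.prems(1)
  show ?case
  proof (cases m)
    case 0
    then have "w (int (Suc k)) = 0" using less.prems(2) by simp
    then show ?thesis using signed_zero[OF w] by simp
  next
    case (Suc m')
    show ?thesis
    proof (cases "\<bar>w (int (Suc k))\<bar> = int m")
      case True
      then have "\<bar>w (int (Suc k))\<bar> = int (Suc m')" using Suc by simp
      note c = points_corner[OF w this]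
      have "w (int (Suc k)) = int (Suc m') \<or> w (int (Suc k)) = - int (Suc m')" using True Suc by auto
      then show ?thesis using c Suc by (auto simp: dstep_def)
    next
      case False
      then have p: "\<bar>w (int (Suc k))\<bar> \<le> int m'" using less.prems(2) Suc by simp
      have 1: "dstep (shape (points w k m')) (shape (points w (Suc k) m'))"
        using less.hyps[of k m' w] w p Suc by simp
      show ?thesis
      proof (cases "\<bar>inv w (int (Suc m'))\<bar> \<le> int k")
        case True
        \<comment> \<open>Extending in height is extending in width for the inverse map; the
          induction is over the sum \<open>k + m\<close> and all \<open>w\<close> so that this
          instance is available.\<close>
        have "dstep (shape (points (inv w) m' k)) (shape (points (inv w) (Suc m') k))"
          using less.hyps[of m' k "inv w"] signed_inv[OF w] True Suc by simp
        then have 2: "dstep (shape (points w k m')) (shape (points w k (Suc m')))"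
          by (simp only: shape_points_inv[OF w])
        obtain P U PU SU PV where "four_squares (shape (points w k m')) P (shape (points w (Suc k) m')) U PU SU
            (shape (points w k (Suc m'))) PV (shape (points w (Suc k) (Suc m')))"
          using points_four_squares[OF w p True] by blast
        from four_squares.domino_square[OF this 2 1] show ?thesis
          using Suc by (simp add: domino_square_def)
      next
        case F: False
        \<comment> \<open>The letter \<open>Suc m'\<close> lies outside width \<open>k\<close>, and
          not in column \<open>Suc k\<close> either, since that column has its point lower. So
          raising the height changes neither box.\<close>
        have "inv w (int (Suc m')) \<noteq> int (Suc k)" "inv w (int (Suc m')) \<noteq> - int (Suc k)"
          using signed_inv_iff[OF w] signed_minus[OF w, of "int (Suc k)"] False Suc by auto
        then have "\<not> \<bar>inv w (int (Suc m'))\<bar> \<le> int (Suc k)" using F by auto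
        then show ?thesis using 1 F Suc points_Suc_top[OF w, of k m'] points_Suc_top[OF w, of "Suc k" m'] by simp
      qed
    qed
  qed
qed

lemma domino_square_points:
  assumes w: "signed w" and p: "\<bar>w (int (Suc k))\<bar> \<le> int m" and q: "\<bar>inv w (int (Suc m))\<bar> \<le> int k"
  shows "domino_square (shape (points w k m)) (shape (points w k (Suc m)))
     (shape (points w (Suc k) m)) (shape (points w (Suc k) (Suc m)))"
proof -
  obtain P U PU SU PV where f: "four_squares (shape (points w k m)) P (shape (points w (Suc k) m)) U PU SU
      (shape (points w k (Suc m))) PV (shape (points w (Suc k) (Suc m)))"
    using points_four_squares[OF assms] by blast
  have "dstep (shape (points (inv w) m k)) (shape (points (inv w) (Suc m) k))"
    using dstep_points[OF signed_inv[OF w] q] .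
  then have "dstep (shape (points w k m)) (shape (points w k (Suc m)))"
    by (simp only: shape_points_inv[OF w])
  then show ?thesis using four_squares.domino_square[OF f _ dstep_points[OF w p]] by blast
qed

section \<open>Comparing a map with its composite with the generator\<close>

lemma gen_t_gen_t [simp]: "gen_t (gen_t i) = i"
  by (simp add: gen_t_def)

lemma abs_gen_t [simp]: "\<bar>gen_t i\<bar> = \<bar>i\<bar>"
  by (simp add: gen_t_def)

lemma gen_t_comp_gen_t: "gen_t \<circ> gen_t = id"
  by (simp add: fun_eq_iff)

lemma signed_gen_t: "signed gen_t"
  using o_bij[OF gen_t_comp_gen_t gen_t_comp_gen_t] by (auto simp: signed_def gen_t_def)

lemma inv_gen_t: "inv gen_t = gen_t"
  by (rule inv_unique_comp) (simp_all add: gen_t_comp_gen_t)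

lemma points_comp_gen_t: "points (w \<circ> gen_t) k m = apfst gen_t ` points w k m"
proof -
  have z: "gen_t i = 0 \<longleftrightarrow> i = 0" for i by (simp add: gen_t_def)
  have "(i, v) \<in> points (w \<circ> gen_t) k m \<longleftrightarrow> (gen_t i, v) \<in> points w k m" for i v
    by (auto simp: points_def z)
  moreover have "(i, v) \<in> apfst gen_t ` B \<longleftrightarrow> (gen_t i, v) \<in> B" for i v and B :: "(int \<times> int) set"
    by (auto intro: image_eqI[where x = "(gen_t i, v)"])
  ultimately show ?thesis by auto
qed

lemma greene_remove: "finite A \<Longrightarrow> greene k A \<le> greene k (A - {x}) + 1"
proof -
  assume A: "finite A"
  obtain S f where S: "S \<subseteq> A" "chain_coloring k f S" "greene k A = card S" using greene_obtain[OF A] .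
  have "chain_coloring k f (S - {x})" using S(2) by (auto simp: chain_coloring_def)
  then have "card (S - {x}) \<le> greene k (A - {x})" using S(1) A by (intro greene_ge) auto
  moreover have "card S \<le> card (S - {x}) + 1" using card_Suc_Diff1[of S x] finite_subset[OF S(1) A]
    by (cases "x \<in> S") auto
  ultimately show ?thesis using S(3) by simp
qed

text \<open>\<open>gen_t\<close> keeps the order of all pairs of nonzero indices except
  \<open>-1\<close> and \<open>1\<close>. With \<open>0 < w 1\<close> the two central points
  increase for \<open>w\<close> and decrease after the exchange, so only this comparability is
  lost.\<close>

lemma greene_comp_gen_t:
  assumes w: "signed w" and pos: "0 < w 1"
  shows "greene r (points (w \<circ> gen_t) k m) \<le> greene r (points w k m)"
    and "greene r (points w k m) \<le> greene r (points (w \<circ> gen_t) k m) + 1"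
proof -
  let ?w' = "w \<circ> gen_t"
  have w': "signed ?w'" using signed_comp[OF w signed_gen_t] .
  have inj: "inj_on (apfst gen_t) B" for B :: "(int \<times> int) set"
    by (rule inj_on_inverseI[of _ "apfst gen_t"]) (auto simp: apfst_def map_prod_def split: prod.splits)
  have undo: "points w k m = apfst gen_t ` points ?w' k m"
    using points_comp_gen_t[of ?w' k m] by (simp add: comp_assoc gen_t_comp_gen_t)
  have m1: "w (-1) = - w 1" using signed_minus[OF w, of 1] .
  have pt: "(i, v) \<in> points u k m \<Longrightarrow> i \<noteq> 0 \<and> v = u i" for i v u by (auto simp: points_def)
  have gt: "gen_t i \<le> gen_t j \<longleftrightarrow> i \<le> j" if "i \<noteq> 0" "j \<noteq> 0" "\<bar>i\<bar> \<noteq> 1 \<or> \<bar>j\<bar> \<noteq> 1" for i j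
    using that by (auto simp: gen_t_def)
  show "greene r (points ?w' k m) \<le> greene r (points w k m)"
  proof (rule greene_le_image[where h = "apfst gen_t"])
    fix p q assume a: "p \<in> points ?w' k m" "q \<in> points ?w' k m" "comparable p q"
    obtain i u j v where pq: "p = (i, u)" "q = (j, v)" by (cases p; cases q)
    have ij: "i \<noteq> 0" "j \<noteq> 0" "u = w (gen_t i)" "v = w (gen_t j)" using pt a unfolding pq by fastforce+
    show "comparable (apfst gen_t p) (apfst gen_t q)"
    proof (cases "\<bar>i\<bar> = 1 \<and> \<bar>j\<bar> = 1")
      case True
      then have "(i = 1 \<or> i = -1) \<and> (j = 1 \<or> j = -1)" by auto
      then show ?thesis using ij pos m1 unfolding pq comparable_def by (auto simp: gen_t_def)
    next
      case False
      then show ?thesis using a(3) gt[of i j] gt[of j i] ij(1,2) unfolding pq comparable_def by auto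
    qed
  qed (use generic_finite[OF generic_points[OF w]] inj equalityD2[OF undo] in \<open>simp_all only:\<close>)
  \<comment> \<open>Deleting one central point costs at most one and leaves no pair whose
    comparability the exchange could destroy.\<close>
  have "greene r (points w k m - {(1, w 1)}) \<le> greene r (points ?w' k m)"
  proof (rule greene_le_image[where h = "apfst gen_t"])
    fix p q assume a: "p \<in> points w k m - {(1, w 1)}" "q \<in> points w k m - {(1, w 1)}" "comparable p q"
    obtain i u j v where pq: "p = (i, u)" "q = (j, v)" by (cases p; cases q)
    have ij: "i \<noteq> 0" "j \<noteq> 0" "u = w i" "v = w j" "i \<noteq> 1" "j \<noteq> 1" using pt a unfolding pq by fastforce+
    show "comparable (apfst gen_t p) (apfst gen_t q)"
    proof (cases "\<bar>i\<bar> = 1 \<and> \<bar>j\<bar> = 1")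
      case True
      then have "i = -1" "j = -1" using ij by auto
      then show ?thesis using ij unfolding pq comparable_def by auto
    next
      case False
      then show ?thesis using a(3) gt[of i j] gt[of j i] ij(1,2) unfolding pq comparable_def by auto
    qed
  next
    show "apfst gen_t ` (points w k m - {(1, w 1)}) \<subseteq> points ?w' k m"
      unfolding points_comp_gen_t by (rule image_mono) blast
  qed (use generic_finite[OF generic_points[OF w']] inj in auto)
  then show "greene r (points w k m) \<le> greene r (points ?w' k m) + 1"
    using greene_remove[OF generic_finite[OF generic_points[OF w]], of r k m "(1, w 1)"] by simp
qed

text \<open>The sign of \<open>w 1\<close> alone decides which map has the larger value, for every
  box. Both differences therefore lie in the same set, 0 and 1 or 0 and -1, so they are at most 1
  apart.\<close>

lemma top_rows_comp_gen_t:
  assumes w: "signed w"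
  shows "\<bar>(int (top_rows r (shape (points w k m))) - int (top_rows r (shape (points (w \<circ> gen_t) k m))))
     - (int (top_rows r (shape (points w k' m'))) - int (top_rows r (shape (points (w \<circ> gen_t) k' m'))))\<bar> \<le> 1"
proof -
  have w': "signed (w \<circ> gen_t)" using signed_comp[OF w signed_gen_t] .
  have id: "w \<circ> gen_t \<circ> gen_t = w" by (simp add: comp_assoc gen_t_comp_gen_t)
  have "w 1 \<noteq> 0" using signed_zero[OF w, of 1] by simp
  then consider "0 < w 1" | "0 < (w \<circ> gen_t) 1" using signed_minus[OF w, of 1] by (force simp: gen_t_def)
  then show ?thesis
  proof cases
    case 1
    then show ?thesis
      using greene_comp_gen_t[OF w 1, of r k m] greene_comp_gen_t[OF w 1, of r k' m']
      unfolding greene_eq_top_rows[OF generic_points[OF w]] greene_eq_top_rows[OF generic_points[OF w']] by linarith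
  next
    case 2
    then show ?thesis
      using greene_comp_gen_t[OF w' 2, of r k m] greene_comp_gen_t[OF w' 2, of r k' m'] unfolding id
      unfolding greene_eq_top_rows[OF generic_points[OF w]] greene_eq_top_rows[OF generic_points[OF w']] by linarith
  qed
qed

text \<open>The first domino may be horizontal for one map and vertical for the other, but its black
  cell is always the corner. This starts the comparison.\<close>

lemma dstep_empty_black: "dstep {} Z \<Longrightarrow> black Z = {(0, 0)}"
proof -
  assume "dstep {} Z"
  then obtain i j where "hstep {} Z i j \<or> vstep {} Z i j" by (auto simp: dstep_def)
  then show ?thesis
  proof
    assume h: "hstep {} Z i j"
    then have "i = 0" "j = 0" using hstep_cells(1)[OF h, of 0] hstep_cells(2)[OF h, of 0] by auto
    then show ?thesis using h by (auto simp: hstep_def black_def)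
  next
    assume h: "vstep {} Z i j"
    then have "i = 0" "j = 0" using vstep_cells(1)[OF h, of 0] vstep_cells(2)[OF h, of 0] by auto
    then show ?thesis using h by (auto simp: vstep_def black_def)
  qed
qed

lemma shape_empty [simp]: "shape {} = {}"
  using shape_eq_diagram_RS_tableau(1)[of "[]"] by (simp add: RS_tableau_def)

lemma points_0 [simp]: "points w 0 m = {}" "signed w \<Longrightarrow> points w k 0 = {}"
  by (auto simp: points_def signed_zero)

text \<open>The two maps agree in absolute value everywhere and in sign outside the columns
  \<open>-1\<close> and \<open>1\<close>, so each enlargement of the box is of the same type for
  both.\<close>

theorem black_shape_comp_gen_t:
  assumes w: "signed w"
  shows "black (shape (points w k m)) = black (shape (points (w \<circ> gen_t) k m))"
proof (induction "k + m" arbitrary: k m rule: less_induct)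
  case less
  let ?w' = "w \<circ> gen_t"
  have w': "signed ?w'" using signed_comp[OF w signed_gen_t] .
  have aw: "\<bar>?w' i\<bar> = \<bar>w i\<bar>" for i using signed_minus[OF w, of 1] by (simp add: gen_t_def)
  have inv': "inv ?w' = gen_t \<circ> inv w"
    using o_inv_distrib[of w gen_t] w signed_gen_t by (simp add: signed_def inv_gen_t)
  have ai: "\<bar>inv ?w' i\<bar> = \<bar>inv w i\<bar>" for i by (simp add: inv')
  show ?case
  proof (cases "k = 0 \<or> m = 0")
    case True
    then show ?thesis using w w' by auto
  next
    case False
    then obtain k1 m1 where k: "k = Suc k1" and m: "m = Suc m1" by (metis not0_implies_Suc)
    let ?K = "int (Suc k1)" and ?M = "int (Suc m1)"
    \<comment> \<open>In turn: the new columns are empty; only the central columns are present, the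
      one place where the maps differ; the new pair sits in corners; the new rows are empty; a
      proper square, with column pair and row pair separate.\<close>
    consider "\<bar>w ?K\<bar> > ?M" | "\<bar>w ?K\<bar> \<le> ?M" "k1 = 0" | "\<bar>w ?K\<bar> = ?M" "k1 \<noteq> 0"
      | "\<bar>w ?K\<bar> \<le> int m1" "\<bar>inv w ?M\<bar> > int k1" | "\<bar>w ?K\<bar> \<le> int m1" "\<bar>inv w ?M\<bar> \<le> int k1"
      by linarith
    then show ?thesis
    proof cases
      case 1
      then show ?thesis unfolding k m
        using points_Suc_right[OF w, of k1 "Suc m1"] points_Suc_right[OF w', of k1 "Suc m1"] aw[of ?K]
          less[of k1 m] k m by simp
    next
      case 2
      have "black (shape (points w (Suc 0) m)) = {(0, 0)}"
        using dstep_points[OF w, of 0 m] 2 m by (intro dstep_empty_black) simp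
      moreover have "black (shape (points ?w' (Suc 0) m)) = {(0, 0)}"
        using dstep_points[OF w', of 0 m] 2 m aw[of 1] by (intro dstep_empty_black) simp
      ultimately show ?thesis using 2 k by simp
    next
      case 3
      have eq: "?w' ?K = w ?K" using 3(2) by (simp add: gen_t_def)
      have IH: "black (shape (points w k1 m1)) = black (shape (points ?w' k1 m1))"
        using less[of k1 m1] k m by simp
      note c = points_corner(3,4)[OF w 3(1)] and c' = points_corner(3,4)[OF w', of k1 m1, unfolded eq, OF 3(1)]
      consider "w ?K = ?M" | "w ?K = - ?M" using 3(1) by linarith
      then show ?thesis
      proof cases
        case 1
        show ?thesis unfolding k m using c(1)[OF 1] c'(1)[OF 1] hstep_black_in_row black_in_row_unique[OF _ _ IH] by blast
      next
        case 2
        show ?thesis unfolding k m using c(2)[OF 2] c'(2)[OF 2] vstep_black_in_col black_in_col_unique[OF _ _ IH] by blast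
      qed
    next
      case 4
      have "\<bar>w ?K\<bar> \<noteq> ?M" using 4(1) by simp
      then have "inv w ?M \<noteq> ?K" "inv w ?M \<noteq> - ?K"
        using signed_inv_iff[OF w] signed_minus[OF w, of ?K] by auto
      then have "\<not> \<bar>inv w ?M\<bar> \<le> int (Suc k1)" using 4(2) by auto
      then show ?thesis unfolding k m
        using points_Suc_top[OF w, of "Suc k1" m1] points_Suc_top[OF w', of "Suc k1" m1] ai[of ?M]
          less[of k m1] k m by simp
    next
      case 5
      have sq: "domino_square (shape (points w k1 m1)) (shape (points w k1 (Suc m1)))
          (shape (points w (Suc k1) m1)) (shape (points w (Suc k1) (Suc m1)))"
        using domino_square_points[OF w 5] .
      have sq': "domino_square (shape (points ?w' k1 m1)) (shape (points ?w' k1 (Suc m1)))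
          (shape (points ?w' (Suc k1) m1)) (shape (points ?w' (Suc k1) (Suc m1)))"
        by (rule domino_square_points[OF w']) (use 5 aw ai in simp_all)
      show ?thesis unfolding k m
        by (rule domino_square_black[OF sq sq' _ _ _ top_rows_comp_gen_t[OF w]])
          (use less[of k1 m1] less[of k1 "Suc m1"] less[of "Suc k1" m1] k m in simp_all)
    qed
  qed
qed

lemma black_shape_gen_t_comp:
  assumes w: "signed w"
  shows "black (shape (points w k m)) = black (shape (points (gen_t \<circ> w) k m))"
proof -
  have w': "signed (gen_t \<circ> w)" using signed_comp[OF signed_gen_t w] .
  have "inv (gen_t \<circ> w) = inv w \<circ> gen_t"
    using o_inv_distrib[of gen_t w] w signed_gen_t by (simp add: signed_def inv_gen_t)
  then show ?thesis
    using black_shape_comp_gen_t[OF signed_inv[OF w], of m k] shape_points_inv[OF w, of m k] shape_points_inv[OF w', of m k]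
    by simp
qed

section \<open>Back to words and partitions\<close>

lemma shape_points_mvec:
  assumes w: "signed w" and n: "\<And>i. \<bar>i\<bar> \<le> int n \<Longrightarrow> \<bar>w i\<bar> \<le> int n"
  shows "shape (points w n n) = diagram (RS_tableau (mvec n w))"
proof -
  define js where "js = map uminus (rev [1..int n]) @ [1..int n]"
  define xs where "xs = map (\<lambda>i. (i, w i)) js"
  have "i \<in> uminus ` {1..int n} \<longleftrightarrow> - i \<in> {1..int n}" for i :: int
    by (auto intro: image_eqI[where x = "- i"])
  then have set_js: "set js = {i. i \<noteq> 0 \<and> \<bar>i\<bar> \<le> int n}"
    unfolding js_def by auto
  have "sorted_wrt (<) js"
    unfolding js_def by (auto simp: sorted_wrt_append sorted_wrt_map sorted_wrt_rev)
  then have "distinct js" and sorted: "sorted_wrt (\<lambda>p q. fst p < fst q) xs"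
    by (auto simp: strict_sorted_iff xs_def sorted_wrt_map)
  \<comment> \<open>Central symmetry turns the letters at the negative positions into the negated
    reversal of the right half.\<close>
  have "map snd xs = mvec n w"
    by (simp add: xs_def js_def mvec_def wvec_def rev_map comp_def signed_minus[OF w])
  moreover have "set xs = points w n n"
    unfolding xs_def set_map set_js using n by (auto simp: points_def)
  moreover have "distinct (map snd xs)"
    using signed_eq_iff[OF w] \<open>distinct js\<close> by (simp add: xs_def distinct_map inj_on_def comp_def)
  ultimately show ?thesis using shape_eq_diagram_RS_tableau(1)[OF sorted] by simp
qed

lemma card_even_lessThan: "card {j. j < l \<and> even (a + j)} = (if even a then (l + 1) div 2 else l div 2)"
proof (induction l)
  case (Suc l)
  have "{j. j < Suc l \<and> even (a + j)} =
      (if even (a + l) then insert l {j. j < l \<and> even (a + j)} else {j. j < l \<and> even (a + j)})"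
    by (auto simp: less_Suc_eq)
  then show ?case using Suc by (cases "even a"; cases "even l") simp_all
qed simp

text \<open>Part \<open>i\<close> is row \<open>i - 1\<close> of the diagram, so odd parts are rows
  of even index, where black starts at column 0 and the count rounds up. Hence equal black cells
  mean equal \<open>part_ev\<close>.\<close>

lemma part_ev_RS_shape:
  "part_ev (RS_shape x) i = (if i = 0 then 0 else card {j. (i - 1, j) \<in> black (diagram (RS_tableau x))})"
proof (cases i)
  case 0
  then show ?thesis by (simp add: part_ev_def RS_shape_def part_of_list_def)
next
  case (Suc a)
  have "{j. (a, j) \<in> black (diagram (RS_tableau x))} = {j. j < RS_shape x (Suc a) \<and> even (a + j)}"
    by (auto simp: mem_black diagram_def RS_shape_def part_of_list_def split: if_splits)
  then have "card {j. (a, j) \<in> black (diagram (RS_tableau x))} =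
      (if even a then (RS_shape x (Suc a) + 1) div 2 else RS_shape x (Suc a) div 2)"
    by (simp only: card_even_lessThan)
  then show ?thesis using Suc by (simp add: part_ev_def)
qed

lemma part_ev_RS_shape_eqI:
  assumes "black (diagram (RS_tableau x)) = black (diagram (RS_tableau y))"
  shows "part_ev (RS_shape x) = part_ev (RS_shape y)"
  by (rule ext) (simp add: part_ev_RS_shape assms)

theorem mainTheorem4:
  fixes n :: nat and w :: "int \<Rightarrow> int"
  assumes "w \<in> signed_perms n"
  shows "part_ev (RS_shape (mvec n w)) = part_ev (RS_shape (mvec n (gen_t \<circ> w)))
       \<and> part_ev (RS_shape (mvec n w)) = part_ev (RS_shape (mvec n (w \<circ> gen_t)))"
proof -
  have p: "w permutes ({-int n..-1} \<union> {1..int n})" and m: "\<forall>i. w (-i) = - w i"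
    using assms by (auto simp: signed_perms_def)
  \<comment> \<open>\<open>permutes\<close> makes \<open>w\<close> a bijection of all integers, so
    \<open>signed\<close> holds without mention of \<open>n\<close>; the size returns only through
    the box.\<close>
  have w: "signed w" using p m permutes_bij by (auto simp: signed_def)
  have n: "\<bar>w i\<bar> \<le> int n" if "\<bar>i\<bar> \<le> int n" for i
  proof (cases "i = 0")
    case False
    then have "i \<in> {-int n..-1} \<union> {1..int n}" using that by auto
    then have "w i \<in> {-int n..-1} \<union> {1..int n}" using permutes_in_image[OF p] by blast
    then show ?thesis by auto
  qed (use signed_zero[OF w, of 0] in simp)
  have sh: "shape (points w n n) = diagram (RS_tableau (mvec n w))"
    by (rule shape_points_mvec[OF w n])
  have "shape (points (gen_t \<circ> w) n n) = diagram (RS_tableau (mvec n (gen_t \<circ> w)))"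
    by (rule shape_points_mvec[OF signed_comp[OF signed_gen_t w]]) (simp add: n)
  then have "part_ev (RS_shape (mvec n w)) = part_ev (RS_shape (mvec n (gen_t \<circ> w)))"
    using black_shape_gen_t_comp[OF w, of n n] sh by (intro part_ev_RS_shape_eqI) simp
  moreover have "shape (points (w \<circ> gen_t) n n) = diagram (RS_tableau (mvec n (w \<circ> gen_t)))"
    by (rule shape_points_mvec[OF signed_comp[OF w signed_gen_t]]) (simp add: n)
  then have "part_ev (RS_shape (mvec n w)) = part_ev (RS_shape (mvec n (w \<circ> gen_t)))"
    using black_shape_comp_gen_t[OF w, of n n] sh by (intro part_ev_RS_shape_eqI) simp
  ultimately show ?thesis by simp
qed

end
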